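(* Let $\psi:[0,1]\to\mathbb{R}_+$ be twice continuously differentiable with non-vanishing curvature ($\psi''(x)\neq0$ for all $x\in[0,1]$), and let $L<\infty$ satisfy $\psi(x)\le L$ for all $x\in[0,1]$. Then there is a constant $c>0$ depending only on $\psi$ and $L$ such that for every $M\ge1$, every point set $T_M=\{\boldsymbol{x}_1,\ldots,\boldsymbol{x}_M\}\subset[0,1)^2$ for which the acceptance-rejection sampler accepts $N\ge1$ points, and every $R>0$, $$D^*_{N,\psi}\big(Q_N(T_M;\psi)\big)\le c\,\mathcal{Q}_R(T_M).$$
   Context: For $\boldsymbol{n}=(n_1,n_2)\in\mathbb{Z}^2$ let $|\boldsymbol{n}|=\max\{|n_1|,|n_2|\}$. For $T_M=\{\boldsymbol{x}_1,\ldots,\boldsymbol{x}_M\}$ and $R>0$ define the quality criterion $$\mathcal{Q}_R(T_M)=\frac1R+\sum_{\substack{\boldsymbol{n}\in\mathbb{Z}^2\\0<|\boldsymbol{n}|<R}}\Big(\frac{1}{|\boldsymbol{n}|^{3/2}}+\frac{1}{(1+|n_1|)(1+|n_2|)}\Big)\Big|\frac1M\sum_{j=1}^M e^{2\pi\mathrm{i}\,\boldsymbol{n}\cdot\boldsymbol{x}_j}\Big|.$$ Acceptance-rejection sampler: with $A=\{(x_1,x_2)\in[0,1]^2\mid\psi(x_1)\ge Lx_2\}$, $N=\#\{j:\boldsymbol{x}_j\in A\}$ and $Q_N(T_M;\psi)=\{y_1,\ldots,y_N\}$ is the multiset of first coordinates of the points $\boldsymbol{x}_j\in A$. For $P_N=\{p_1,\ldots,p_N\}\subset[0,1]$,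 $D^*_{N,\psi}(P_N)=\sup_{t\in[0,1]}\big|\frac1N\sum_{j=1}^N1_{[0,t)}(p_j)-\frac1C\int_0^t\psi(z)\,dz\big|$ with $C=\int_0^1\psi(z)\,dz>0$. *)

theory Defs
  imports "HOL-Analysis.Analysis"
begin

definition maxnorm :: "int \<times> int \<Rightarrow> int" where
  "maxnorm n = max \<bar>fst n\<bar> \<bar>snd n\<bar>"

definition expsum :: "nat \<Rightarrow> (nat \<Rightarrow> real \<times> real) \<Rightarrow> int \<times> int \<Rightarrow> complex" where
  "expsum M x n = (1 / of_nat M) *
     (\<Sum>j<M. cis (2 * pi * (of_int (fst n) * fst (x j) + of_int (snd n) * snd (x j))))"

definition Qcrit :: "real \<Rightarrow> nat \<Rightarrow> (nat \<Rightarrow> real \<times> real) \<Rightarrow> real" where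
  "Qcrit R M x = 1 / R +
     (\<Sum>n \<in> {n :: int \<times> int. 0 < maxnorm n \<and> real_of_int (maxnorm n) < R}.
        (1 / (real_of_int (maxnorm n)) powr (3/2)
         + 1 / ((1 + real_of_int \<bar>fst n\<bar>) * (1 + real_of_int \<bar>snd n\<bar>)))
        * cmod (expsum M x n))"

definition accept_region :: "(real \<Rightarrow> real) \<Rightarrow> real \<Rightarrow> (real \<times> real) set" where
  "accept_region \<psi> L = {(a, b). a \<in> {0..1} \<and> b \<in> {0..1} \<and> \<psi> a \<ge> L * b}"

definition ar_sample :: "(real \<Rightarrow> real) \<Rightarrow> real \<Rightarrow> nat \<Rightarrow> (nat \<Rightarrow> real \<times> real) \<Rightarrow> real list" where
  "ar_sample \<psi> L M x = map (\<lambda>j. fst (x j)) (filter (\<lambda>j. x j \<in> accept_region \<psi> L) [0..<M])"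

definition star_disc_psi :: "(real \<Rightarrow> real) \<Rightarrow> real list \<Rightarrow> real" where
  "star_disc_psi \<psi> p = (SUP t \<in> {0..1}.
     \<bar>real (length (filter (\<lambda>y. y < t) p)) / real (length p)
      - integral {0..t} \<psi> / integral {0..1} \<psi>\<bar>)"

end

theory Submission
  imports Defs
begin

text \<open>Write \<open>g = \<psi> / L\<close>. Apart from points on the graph, the indicator of \<open>b \<le> g a\<close> is
  \<open>g a + saw (b - g a) - saw b\<close> on the unit square, where \<open>saw u = frac u - 1/2\<close>. The first term
  is handled by a one-dimensional Koksma inequality, so it remains to bound the averages over the
  points of \<open>saw (b - g a)\<close>, cut off to \<open>a < t\<close>, and the same with \<open>g = 0\<close>. As \<open>saw\<close> jumps
  only downwards, such an average, viewed as a function \<open>E\<close> of a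
  translation of the torus, keeps a nearly extremal value on a whole box of side length \<open>O(1/R)\<close>
  after a suitable vertical shift. Convolving \<open>E\<close> with a product of Fejer kernels therefore loses at
  most a constant factor and \<open>O(1/R)\<close>, and it leaves a trigonometric polynomial of degree below \<open>R\<close>. Its
  coefficients are \<open>1/k\<close> times integrals of \<open>cis (- 2 pi (l y + k g y))\<close>, which van der Corput's
  first and second derivative tests bound by the weights of the quality criterion; the second test
  is where the curvature enters.\<close>

subsection \<open>The sawtooth function and the Fejer kernel\<close>

text \<open>The obstacle is formed by the vertical lines at 0 and \<open>t\<close>. Across them the
  cut-off function jumps in both directions, so the one-sided argument for the sawtooth fails there.
  The points that cross such a line are counted instead, and an arc count is again a difference of
  one-dimensional sawtooth averages. Hence the one-dimensional estimate is proved separately and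
  enters the two-dimensional one as the quantity \<open>D1\<close>. The Fejer kernel is chosen
  because it is nonnegative: the unknown supremum \<open>D\<close> may stand on both sides of an
  inequality and be absorbed, provided that two convolutions together keep more than half of the
  mass in the window. A window of radius \<open>4/K\<close> keeps 7/8 each time, and 49/64 exceeds
  3/4. Since \<open>saw\<close> has mean zero, frequencies with vertical component 0 drop out of the
  smoothed average, and the factor 1/|k| of the others lifts the exponent 1/2 of the second
  derivative test to 3/2.\<close>

definition saw :: "real \<Rightarrow> real" where
  "saw u = frac u - 1/2"

lemma saw_bound: "\<bar>saw u\<bar> \<le> 1/2"
  using frac_ge_0[of u] frac_lt_1[of u] unfolding saw_def by linarith

lemma saw_frac: "saw (frac u) = saw u"
  by (simp add: saw_def)

text \<open>The floor is monotone, so a step to the left crosses jumps only upwards. This one-sided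
  bound is valid across jumps and drives every later shift argument.\<close>

lemma saw_diff_ge:
  assumes "h \<ge> 0"
  shows "saw (u - h) \<ge> saw u - h"
proof -
  have "\<lfloor>u - h\<rfloor> \<le> \<lfloor>u\<rfloor>"
    using assms by (intro floor_mono) auto
  then have "real_of_int \<lfloor>u - h\<rfloor> \<le> real_of_int \<lfloor>u\<rfloor>"
    by simp
  then show ?thesis
    by (simp add: saw_def frac_def)
qed

lemma saw_add_le: "h \<ge> 0 \<Longrightarrow> saw (u + h) \<le> saw u + h"
  using saw_diff_ge[of h "u + h"] by simp

lemma cis_int_frac: "cis (2 * pi * (of_int n * frac u)) = cis (2 * pi * (of_int n * u))"
proof -
  have *: "2 * pi * (of_int n * u) = 2 * pi * (of_int n * frac u) + 2 * pi * of_int (n * \<lfloor>u\<rfloor>)"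
    by (simp add: frac_def algebra_simps)
  have "cis (2 * pi * of_int (n * \<lfloor>u\<rfloor>)) = 1"
    by (intro cis_multiple_2pi) auto
  then show ?thesis
    unfolding * by (simp add: cis_mult [symmetric] del: of_int_mult)
qed

lemma cis_int_minus_frac:
  "cis (- (2 * pi * (of_int n * frac u))) = cis (- (2 * pi * (of_int n * u)))"
  using cis_int_frac[of "-n" u] by simp

lemma has_vector_derivative_cis_comp:
  assumes "(f has_real_derivative f') (at x within S)"
  shows "((\<lambda>x. cis (f x)) has_vector_derivative (\<i> * of_real f' * cis (f x))) (at x within S)"
  unfolding has_vector_derivative_def
  using has_derivative_cis[OF assms[unfolded has_field_derivative_def]]
  by (simp add: scaleR_conv_of_real mult_ac)

lemma has_integral_cis_int:
  fixes n :: int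
  shows "((\<lambda>z. cis (2 * pi * (of_int n * z))) has_integral (if n = 0 then 1 else 0)) {-(1/2)..1/2}"
proof (cases "n = 0")
  case True
  show ?thesis using has_integral_const_real[of "1::complex" "-(1/2)" "1/2"] True by simp
next
  case False
  let ?F = "\<lambda>z. cis (2 * pi * (of_int n * z)) / (2 * pi * \<i> * of_int n)"
  have "((\<lambda>z. cis (2 * pi * (of_int n * z))) has_integral (?F (1/2) - ?F (-(1/2)))) {-(1/2)..1/2}"
  proof (rule fundamental_theorem_of_calculus)
    fix z :: real
    have "((\<lambda>z. 2 * pi * (of_int n * z)) has_real_derivative 2 * pi * of_int n) (at z within {-(1/2)..1/2})"
      by (auto intro!: derivative_eq_intros)
    from has_vector_derivative_divide[OF has_vector_derivative_cis_comp[OF this], of "2 * pi * \<i> * of_int n"]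
    show "(?F has_vector_derivative cis (2 * pi * (of_int n * z))) (at z within {-(1/2)..1/2})"
      using False by simp
  qed auto
  moreover have "cis (2 * pi * (of_int n * (1/2))) = cis (2 * pi * (of_int n * (-(1/2))))"
  proof -
    have "2 * pi * (of_int n * (1/2)) = 2 * pi * (of_int n * (-(1/2))) + 2 * pi * of_int n"
      by (simp add: algebra_simps)
    moreover have "cis (2 * pi * of_int n) = 1"
      by (intro cis_multiple_2pi) auto
    ultimately show ?thesis
      by (metis cis_mult mult.right_neutral)
  qed
  ultimately show ?thesis using False by simp
qed

section \<open>The Fejer kernel: expansion, tails, convolution\<close>

definition fejer :: "nat \<Rightarrow> real \<Rightarrow> real" where
  "fejer K z = (cmod (\<Sum>k<K. cis (2 * pi * (of_nat k * z))))\<^sup>2 / K"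

text \<open>For \<open>K > 0\<close> this is the triangle function max(0, 1 - |n|/K). Counting pairs
  makes the expansion of the squared modulus a mere regrouping by differences.\<close>

definition fejer_coeff :: "nat \<Rightarrow> int \<Rightarrow> real" where
  "fejer_coeff K n = card {(p, q). p < K \<and> q < K \<and> int p - int q = n} / K"

lemma fejer_nonneg: "fejer K z \<ge> 0"
  by (simp add: fejer_def)

lemma fejer_coeff_nonneg: "fejer_coeff K n \<ge> 0"
  by (simp add: fejer_coeff_def)

lemma fejer_coeff_le_1: "fejer_coeff K n \<le> 1"
proof -
  have "card {(p, q). p < K \<and> q < K \<and> int p - int q = n} \<le> card {..<K}"
    by (rule card_inj_on_le[where f = fst]) (auto simp: inj_on_def)
  then show ?thesis
    by (cases "K = 0") (auto simp: fejer_coeff_def divide_simps)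
qed

lemma fejer_coeff_0:
  assumes "K > 0"
  shows "fejer_coeff K 0 = 1"
proof -
  have "{(p, q). p < K \<and> q < K \<and> int p - int q = 0} = (\<lambda>p. (p, p)) ` {..<K}"
    by auto
  then have "card {(p, q). p < K \<and> q < K \<and> int p - int q = 0} = K"
    by (simp add: card_image inj_on_def)
  then show ?thesis
    using assms by (simp add: fejer_coeff_def)
qed

text \<open>Strict at both ends: degrees reach at most \<open>K - 1\<close>, which lies below
  \<open>R\<close> when \<open>K\<close> is the ceiling of \<open>R\<close>.\<close>

abbreviation freqs :: "nat \<Rightarrow> int set" where
  "freqs K \<equiv> {- int K<..<int K}"

lemma fejer_expand:
  "complex_of_real (fejer K z) =
     (\<Sum>n\<in>freqs K. of_real (fejer_coeff K n) * cis (2 * pi * (of_int n * z)))"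
proof -
  let ?P = "{..<K} \<times> {..<K}" and ?d = "\<lambda>(p, q). int p - int q"
  let ?c = "\<lambda>n. cis (2 * pi * (of_int n * z))"
  have "complex_of_real ((cmod (\<Sum>k<K. cis (2 * pi * (of_nat k * z))))\<^sup>2) =
      (\<Sum>p<K. cis (2 * pi * (of_nat p * z))) * (\<Sum>q<K. cis (- (2 * pi * (of_nat q * z))))"
    by (simp add: complex_norm_square cis_cnj del: of_real_power)
  also have "\<dots> = (\<Sum>(p, q)\<in>?P. cis (2 * pi * (of_nat p * z)) * cis (- (2 * pi * (of_nat q * z))))"
    by (simp add: sum_product sum.cartesian_product)
  also have "\<dots> = (\<Sum>y\<in>?P. ?c (?d y))"
    by (intro sum.cong) (auto simp: cis_mult algebra_simps)
  also have "\<dots> = (\<Sum>n\<in>freqs K. \<Sum>y | y \<in> ?P \<and> ?d y = n. ?c (?d y))"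
    by (rule sum.group [symmetric]) auto
  also have "\<dots> = (\<Sum>n\<in>freqs K. of_nat (card {y. y \<in> ?P \<and> ?d y = n}) * ?c n)"
    by (intro sum.cong refl) simp
  also have "\<dots> = (\<Sum>n\<in>freqs K. of_nat (card {(p, q). p < K \<and> q < K \<and> int p - int q = n}) * ?c n)"
    by (intro sum.cong refl arg_cong2[of _ _ _ _ "(*)"] arg_cong[of _ _ of_nat] arg_cong[of _ _ card]) auto
  finally show ?thesis
    by (simp add: fejer_def fejer_coeff_def sum_divide_distrib)
qed

lemma continuous_on_fejer [continuous_intros]:
  assumes "continuous_on S f"
  shows "continuous_on S (\<lambda>z. fejer K (f z))"
proof (cases "K = 0")
  case False
  show ?thesis unfolding fejer_def cis_conv_exp
    using False by (intro continuous_intros assms) auto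
qed (simp add: fejer_def)

lemma has_integral_fejer:
  assumes "K > 0"
  shows "(fejer K has_integral 1) {-(1/2)..1/2}"
proof -
  have "((\<lambda>z. complex_of_real (fejer K z)) has_integral
      (\<Sum>n\<in>freqs K. of_real (fejer_coeff K n) * (if n = 0 then 1 else 0))) {-(1/2)..1/2}"
    unfolding fejer_expand
    by (intro has_integral_sum has_integral_mult_right has_integral_cis_int) auto
  moreover have "(\<Sum>n\<in>freqs K. complex_of_real (fejer_coeff K n) * (if n = 0 then 1 else 0)) = 1"
    using assms by (simp add: fejer_coeff_0 if_distrib cong: if_cong)
  ultimately have "((\<lambda>z. complex_of_real (fejer K z)) has_integral 1) {-(1/2)..1/2}"
    by simp
  from has_integral_linear[OF this bounded_linear_Re] show ?thesis
    by (simp add: o_def)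
qed

text \<open>Jordan's inequality: sine is concave on \<open>{0..pi}\<close>, so it lies above its
  chord from 0 to pi/2.\<close>

lemma sin_ge_chord:
  assumes "0 \<le> x" "x \<le> pi / 2"
  shows "sin x \<ge> 2 / pi * x"
proof -
  have "convex_on {0..pi} (\<lambda>x. - sin x)"
    by (rule f''_ge0_imp_convex[where f' = "\<lambda>x. - cos x" and f'' = sin])
       (auto intro!: derivative_eq_intros sin_ge_zero)
  from convex_onD[OF this, of "2 / pi * x" 0 "pi / 2"] show ?thesis
    using assms by (simp add: field_simps)
qed

text \<open>The exponential sum is geometric with ratio \<open>?w\<close>: the numerator has modulus
  at most 2, and |w - 1| = 2 |sin(pi z)| is at least 4 |z| by Jordan's inequality.\<close>

lemma fejer_le:
  assumes "z \<noteq> 0" "\<bar>z\<bar> \<le> 1/2"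
  shows "fejer K z \<le> 1 / (4 * real K * z\<^sup>2)"
proof (cases "K = 0")
  case False
  let ?w = "cis (2 * pi * z)"
  have w: "cmod (?w - 1) \<ge> 4 * \<bar>z\<bar>"
  proof -
    have "cmod (?w - 1) = 2 * \<bar>sin (pi * z)\<bar>"
    proof -
      have "?w - 1 = cis (pi * z) * (cis (pi * z) - cis (- (pi * z)))"
        by (simp add: algebra_simps cis_mult)
      also have "cis (pi * z) - cis (- (pi * z)) = 2 * \<i> * sin (pi * z)"
        by (simp add: complex_eq_iff)
      finally show ?thesis
        by (simp add: norm_mult)
    qed
    moreover have "\<bar>sin (pi * z)\<bar> = sin (pi * \<bar>z\<bar>)"
    proof -
      have "pi * \<bar>z\<bar> \<le> pi * 1"
        using assms by (intro mult_left_mono) auto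
      then have "sin (pi * \<bar>z\<bar>) \<ge> 0"
        by (intro sin_ge_zero) auto
      then show ?thesis
        by (cases "z \<ge> 0") (simp_all add: abs_if split: if_splits)
    qed
    moreover have "sin (pi * \<bar>z\<bar>) \<ge> 2 / pi * (pi * \<bar>z\<bar>)"
      using assms by (intro sin_ge_chord) auto
    ultimately show ?thesis by simp
  qed
  then have "?w \<noteq> 1"
    using assms by auto
  have "(\<Sum>k<K. cis (2 * pi * (of_nat k * z))) = (\<Sum>k<K. ?w ^ k)"
  proof (rule sum.cong)
    show "cis (2 * pi * (of_nat k * z)) = ?w ^ k" for k
      unfolding Complex.DeMoivre by (rule arg_cong[of _ _ cis]) simp
  qed simp
  also have "\<dots> = (?w ^ K - 1) / (?w - 1)"
    using \<open>?w \<noteq> 1\<close> by (rule geometric_sum)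
  also have "cmod \<dots> \<le> 2 / (4 * \<bar>z\<bar>)"
    unfolding norm_divide
  proof (rule frac_le)
    show "cmod (?w ^ K - 1) \<le> 2"
      using norm_triangle_ineq4[of "?w ^ K" 1] by (simp add: norm_power)
  qed (use w assms in auto)
  finally have "(cmod (\<Sum>k<K. cis (2 * pi * (of_nat k * z))))\<^sup>2 \<le> (1 / (2 * \<bar>z\<bar>))\<^sup>2"
    by (intro power_mono) auto
  then show ?thesis
    using False by (simp add: fejer_def field_simps power2_eq_square)
qed (simp add: fejer_def)

lemma integral_fejer_le:
  assumes "K > 0" "0 < d" "d \<le> 1/2"
  shows "integral {d..1/2} (fejer K) \<le> 1 / (4 * real K * d)"
    and "integral {-(1/2)..-d} (fejer K) \<le> 1 / (4 * real K * d)"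
proof -
  have *: "((\<lambda>z. 1 / (4 * real K * z\<^sup>2)) has_integral (- 1 / (4 * real K * (1/2)) - - 1 / (4 * real K * d))) {d..1/2}"
    using assms
    by (intro fundamental_theorem_of_calculus)
       (auto intro!: derivative_eq_intros simp: power2_eq_square
             simp flip: has_real_derivative_iff_has_vector_derivative)
  have "integral {d..1/2} (fejer K) \<le> - 1 / (4 * real K * (1/2)) - - 1 / (4 * real K * d)"
  proof -
    have "integral {d..1/2} (fejer K) \<le> integral {d..1/2} (\<lambda>z. 1 / (4 * real K * z\<^sup>2))"
    proof (intro integral_le has_integral_integrable[OF *])
      show "fejer K integrable_on {d..1/2}"
        by (intro integrable_continuous_real continuous_intros)
      fix z assume "z \<in> {d..1/2}"
      then show "fejer K z \<le> 1 / (4 * real K * z\<^sup>2)"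
        using assms fejer_le[of z K] by simp
    qed
    then show ?thesis by (simp only: integral_unique[OF *])
  qed
  also have "\<dots> \<le> 1 / (4 * real K * d)"
    using assms by simp
  finally show 1: "integral {d..1/2} (fejer K) \<le> 1 / (4 * real K * d)" .
  \<comment> \<open>Negating \<open>z\<close> conjugates the exponential sum, so the left tail
    mirrors the right one.\<close>
  have "fejer K (- z) = fejer K z" for z
  proof -
    have "(\<Sum>k<K. cis (2 * pi * (of_nat k * - z))) = cnj (\<Sum>k<K. cis (2 * pi * (of_nat k * z)))"
      by (simp add: cis_cnj)
    then show ?thesis
      unfolding fejer_def by (metis complex_mod_cnj)
  qed
  then have "integral {-(1/2)..-d} (fejer K) = integral {d..1/2} (fejer K)"
    using Henstock_Kurzweil_Integration.integral_reflect_real[of "1/2" d "fejer K"] by simp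
  with 1 show "integral {-(1/2)..-d} (fejer K) \<le> 1 / (4 * real K * d)" by simp
qed

text \<open>Each tail beyond \<open>4/K\<close> carries at most 1/16 of the total mass 1. The
  condition \<open>K \<ge> 8\<close> makes the window fit into one period.\<close>

lemma fejer_mass:
  assumes "K \<ge> 8"
  shows "integral {-(4/K)..4/K} (fejer K) \<ge> 7/8"
proof -
  let ?d = "4 / real K"
  have K: "K > 0" "0 < ?d" "?d \<le> 1/2" "1 / (4 * real K * ?d) = 1/16"
    using assms by (auto simp: field_simps)
  have i: "fejer K integrable_on S" if "S = {a..b}" for S a b
    unfolding that by (intro integrable_continuous_real continuous_intros)
  have "1 = integral {-(1/2)..1/2} (fejer K)"
    using has_integral_fejer[OF K(1)] by (simp add: integral_unique)
  also have "\<dots> = integral {-(1/2)..-?d} (fejer K) + (integral {-?d..?d} (fejer K) + integral {?d..1/2} (fejer K))"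
  proof -
    have d: "- (1/2) \<le> - ?d" "- ?d \<le> 1/2" "-?d \<le> ?d"
      using K(2,3) by linarith+
    have "integral {-?d..1/2} (fejer K) = integral {-?d..?d} (fejer K) + integral {?d..1/2} (fejer K)"
      by (intro Henstock_Kurzweil_Integration.integral_combine [symmetric] i[OF refl] d K)
    moreover have "integral {-(1/2)..1/2} (fejer K) = integral {-(1/2)..-?d} (fejer K) + integral {-?d..1/2} (fejer K)"
      by (intro Henstock_Kurzweil_Integration.integral_combine [symmetric] i[OF refl] d K)
    ultimately show ?thesis by simp
  qed
  finally show ?thesis
    using integral_fejer_le[OF K(1-3)] K(4) by linarith
qed

text \<open>The lower bound survives the part of the kernel's mass outside the window because
  \<open>\<phi> + D\<close> is nonnegative.\<close>
lemma fejer_average_ge: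
  assumes K: "K \<ge> 8"
    and I: "((\<lambda>z. fejer K z * \<phi> z) has_integral I) {-(1/2)..1/2}"
    and D: "\<And>z. \<phi> z \<ge> - D"
    and A: "\<And>z. \<bar>z\<bar> \<le> 4/K \<Longrightarrow> \<phi> z \<ge> A"
    and AD: "A \<ge> - D"
  shows "I \<ge> - D + (A + D) * (7/8)"
proof -
  let ?d = "4 / real K"
  have d: "0 < ?d" "?d \<le> 1/2"
    using K by (auto simp: field_simps)
  let ?\<psi> = "\<lambda>z. fejer K z * (\<phi> z + D)"
  have J: "(?\<psi> has_integral (I + D)) {-(1/2)..1/2}"
    using has_integral_add[OF I has_integral_mult_left[OF has_integral_fejer, of K D]] K
    by (simp add: algebra_simps)
  have sub: "{-?d..?d} \<subseteq> {-(1/2)..1/2}"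
    using d by auto
  have J': "?\<psi> integrable_on {-?d..?d}"
    using integrable_on_subinterval[OF has_integral_integrable[OF J] sub] .
  have "(A + D) * (7/8) \<le> (A + D) * integral {-?d..?d} (fejer K)"
    using fejer_mass[OF K] AD by (intro mult_left_mono) auto
  also have "\<dots> = integral {-?d..?d} (\<lambda>z. fejer K z * (A + D))"
    by (simp add: mult.commute)
  also have "\<dots> \<le> integral {-?d..?d} ?\<psi>"
    using A by (intro integral_le J' mult_left_mono fejer_nonneg)
      (auto intro!: integrable_continuous_real continuous_intros simp: abs_le_iff)
  also have "\<dots> \<le> integral {-(1/2)..1/2} ?\<psi>"
  proof (intro integral_subset_le sub J' has_integral_integrable[OF J])
    have "0 \<le> ?\<psi> z" for z
      using D[of z] by (intro mult_nonneg_nonneg fejer_nonneg) linarith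
    then show "\<forall>z\<in>{-(1/2)..1/2}. 0 \<le> ?\<psi> z" by blast
  qed
  also have "\<dots> = I + D"
    using J by (rule integral_unique)
  finally show ?thesis by linarith
qed

text \<open>Integrals over a period are invariant under translation and reflection;
  \<open>frac\<close> performs the periodic extension of \<open>f\<close> from
  \<open>{0..1}\<close>.\<close>

lemma has_integral_frac:
  fixes f :: "real \<Rightarrow> 'a::banach"
  assumes f: "(f has_integral I) {0..1}"
  shows "((\<lambda>z. f (frac (u - z))) has_integral I) {-(1/2)..1/2}"
proof -
  \<comment> \<open>The argument \<open>u - z\<close> hits the integer \<open>m\<close> at
    \<open>z = c - 1/2\<close>. To the left of this point \<open>frac (u - z)\<close> runs through
    \<open>{0..c}\<close>, to the right through \<open>{c..1}\<close>.\<close>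
  define c where "c = frac (u + 1/2)"
  define m where "m = real_of_int \<lfloor>u + 1/2\<rfloor>"
  have c: "0 \<le> c" "c < 1" "u = m + c - 1/2"
    by (auto simp: c_def m_def frac_lt_1) (simp add: frac_def)
  have f01: "f integrable_on {0..1}"
    using f by blast
  have f0: "(f has_integral integral {0..c} f) {0..c}"
    using c by (intro integrable_integral integrable_on_subinterval[OF f01]) auto
  have f1: "(f has_integral integral {c..1} f) {c..1}"
    using c by (intro integrable_integral integrable_on_subinterval[OF f01]) auto
  have II: "I = integral {0..c} f + integral {c..1} f"
    using c f01 f by (simp add: Henstock_Kurzweil_Integration.integral_combine integral_unique)
  have refl: "((\<lambda>z. f (w - z)) has_integral J) {w-b..w-a}"
    if "(f has_integral J) {a..b}" for a b w and J :: 'a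
  proof -
    have "((\<lambda>z. f (-z)) has_integral J) {-b..-a}"
      using that by (simp add: has_integral_reflect_real)
    then have "((\<lambda>z. f (-(z + - w))) has_integral J) {-b - - w..-a - - w}"
      using has_integral_shift_cbox[of "\<lambda>z. f (-z)" J "-b" "-a" "-w"] by simp
    then show ?thesis by (simp add: algebra_simps)
  qed
  have 1: "((\<lambda>z. f (frac (u - z))) has_integral integral {0..c} f) {-(1/2)..c-1/2}"
  proof (rule has_integral_spike[of "{}"])
    show "((\<lambda>z. f ((c - 1/2) - z)) has_integral integral {0..c} f) {-(1/2)..c-1/2}"
      using refl[OF f0, of "c - 1/2"] by simp
    fix z assume "z \<in> {- (1 / 2)..c - 1 / 2} - {}"
    then show "f (frac (u - z)) = f ((c - 1/2) - z)"
      using c by (intro arg_cong[of _ _ f]) (simp add: frac_unique_iff, simp add: m_def)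
  qed auto
  have 2: "((\<lambda>z. f (frac (u - z))) has_integral integral {c..1} f) {c-1/2..1/2}"
  \<comment> \<open>At this single point \<open>frac\<close> gives 0 while the reflected formula
    gives 1.\<close>
  proof (rule has_integral_spike[of "{c - 1/2}"])
    show "((\<lambda>z. f ((c + 1/2) - z)) has_integral integral {c..1} f) {c-1/2..1/2}"
      using refl[OF f1, of "c + 1/2"] by simp
    fix z assume "z \<in> {c - 1 / 2..1/2} - {c - 1/2}"
    then show "f (frac (u - z)) = f ((c + 1/2) - z)"
      using c by (intro arg_cong[of _ _ f]) (simp add: frac_unique_iff, simp add: m_def)
  qed auto
  show ?thesis
    unfolding II using c by (intro has_integral_combine[OF _ _ 1 2]) auto
qed

text \<open>Convolution with a trigonometric polynomial multiplies Fourier coefficients. The kernel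
  is a finite sum, so no Fourier series has to converge and \<open>h\<close> may jump.\<close>

lemma fejer_convolution:
  fixes h :: "real \<Rightarrow> complex"
  assumes "\<And>n. n \<in> freqs K \<Longrightarrow>
    ((\<lambda>y. cis (- (2 * pi * (of_int n * y))) * h y) has_integral c n) {0..1}"
  shows "((\<lambda>z. of_real (fejer K z) * h (frac (u - z))) has_integral
     (\<Sum>n\<in>freqs K. of_real (fejer_coeff K n) * (cis (2 * pi * (of_int n * u)) * c n))) {-(1/2)..1/2}"
proof -
  have "((\<lambda>z. \<Sum>n\<in>freqs K. of_real (fejer_coeff K n) * (cis (2 * pi * (of_int n * u)) *
        (cis (- (2 * pi * (of_int n * frac (u - z)))) * h (frac (u - z))))) has_integral
     (\<Sum>n\<in>freqs K. of_real (fejer_coeff K n) * (cis (2 * pi * (of_int n * u)) * c n))) {-(1/2)..1/2}"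
    by (intro has_integral_sum has_integral_mult_right has_integral_frac assms) auto
  moreover have "of_real (fejer_coeff K n) * (cis (2 * pi * (of_int n * u)) *
        (cis (- (2 * pi * (of_int n * frac (u - z)))) * h (frac (u - z)))) =
      of_real (fejer_coeff K n) * cis (2 * pi * (of_int n * z)) * h (frac (u - z))" for n z
    unfolding cis_int_minus_frac
    by (simp add: mult.assoc [symmetric]) (simp add: mult.assoc cis_mult algebra_simps)
  ultimately show ?thesis
    by (simp add: fejer_expand sum_distrib_right)
qed

subsection \<open>Oscillatory integrals along the curve\<close>

text \<open>Integration by parts leaves boundary terms \<open>cis (\<phi> x) / \<phi>1 x\<close> and
  a remainder with \<open>\<phi>2 / \<phi>1^2\<close>. The constant sign of \<open>\<phi>2\<close>,
  that is, monotonicity of \<open>\<phi>1\<close>, keeps this remainder at the size of the boundary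
  terms.\<close>

lemma van_der_Corput_first:
  fixes \<phi> \<phi>1 \<phi>2 :: "real \<Rightarrow> real"
  assumes ab: "a \<le> b"
    and d1: "\<And>x. x \<in> {a..b} \<Longrightarrow> (\<phi> has_real_derivative \<phi>1 x) (at x within {a..b})"
    and d2: "\<And>x. x \<in> {a..b} \<Longrightarrow> (\<phi>1 has_real_derivative \<phi>2 x) (at x within {a..b})"
    and cont: "continuous_on {a..b} \<phi>2"
    and sgn: "\<bar>s\<bar> = 1" "\<And>x. x \<in> {a..b} \<Longrightarrow> s * \<phi>2 x \<ge> 0"
    and lam: "\<mu> > 0" "\<And>x. x \<in> {a..b} \<Longrightarrow> \<bar>\<phi>1 x\<bar> \<ge> \<mu>"
  shows "cmod (integral {a..b} (\<lambda>x. cis (\<phi> x))) \<le> 4 / \<mu>"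
proof -
  have nz: "\<phi>1 x \<noteq> 0" if "x \<in> {a..b}" for x
    using lam that by force
  have inv: "\<bar>1 / \<phi>1 x\<bar> \<le> 1 / \<mu>" if "x \<in> {a..b}" for x
    using lam(2)[OF that] lam(1) by (simp add: frac_le)
  have c0: "continuous_on {a..b} \<phi>" and c1: "continuous_on {a..b} \<phi>1"
    by (rule DERIV_continuous_on[OF d1] DERIV_continuous_on[OF d2]; assumption)+
  have dinv: "((\<lambda>x. 1 / \<phi>1 x) has_real_derivative - (\<phi>2 x / (\<phi>1 x)\<^sup>2)) (at x within {a..b})"
    if "x \<in> {a..b}" for x
    using nz[OF that] by (auto intro!: derivative_eq_intros d2[OF that] simp: power2_eq_square)
  define H where "H x = cis (\<phi> x) * of_real (1 / \<phi>1 x)" for x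
  define r where "r x = cis (\<phi> x) * of_real (\<phi>2 x / (\<phi>1 x)\<^sup>2)" for x
  have "((\<lambda>x. \<i> * cis (\<phi> x) - r x) has_integral (H b - H a)) {a..b}"
  proof (rule fundamental_theorem_of_calculus[OF ab])
    fix x assume x: "x \<in> {a..b}"
    have "(H has_vector_derivative
        cis (\<phi> x) * of_real (- (\<phi>2 x / (\<phi>1 x)\<^sup>2)) + (\<i> * of_real (\<phi>1 x) * cis (\<phi> x)) * of_real (1 / \<phi>1 x))
        (at x within {a..b})"
      unfolding H_def
      by (intro has_vector_derivative_mult has_vector_derivative_cis_comp d1 x
          has_vector_derivative_of_real dinv)
    then show "(H has_vector_derivative \<i> * cis (\<phi> x) - r x) (at x within {a..b})"
      using nz[OF x] by (simp add: r_def)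
  qed
  moreover have ri: "r integrable_on {a..b}"
    unfolding r_def using nz
    by (intro integrable_continuous_real continuous_intros c0 c1 cont continuous_on_cis) auto
  ultimately have "((\<lambda>x. \<i> * cis (\<phi> x) - r x + r x) has_integral (H b - H a + integral {a..b} r)) {a..b}"
    by (intro has_integral_add) auto
  then have "((\<lambda>x. \<i> * cis (\<phi> x)) has_integral (H b - H a + integral {a..b} r)) {a..b}"
    by simp
  then have "\<i> * integral {a..b} (\<lambda>x. cis (\<phi> x)) = H b - H a + integral {a..b} r"
    by (simp add: integral_unique flip: integral_mult_right)
  then have "cmod (integral {a..b} (\<lambda>x. cis (\<phi> x))) = cmod (H b - H a + integral {a..b} r)"
    by (metis norm_ii norm_mult mult_1)
  also have "\<dots> \<le> cmod (H b) + cmod (H a) + cmod (integral {a..b} r)"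
    by (meson norm_triangle_le norm_triangle_ineq4 add_mono order_refl)
  also have "cmod (H b) \<le> 1 / \<mu>"
    using inv[of b] ab by (simp add: H_def norm_mult norm_divide)
  also have "cmod (H a) \<le> 1 / \<mu>"
    using inv[of a] ab by (simp add: H_def norm_mult norm_divide)
  also have "cmod (integral {a..b} r) \<le> 2 / \<mu>"
  proof -
    \<comment> \<open>With the sign \<open>s\<close>, the modulus of the remainder is the exact
      derivative of \<open>- s / \<phi>1\<close>, so its integral is a difference of boundary
      values.\<close>
    have I: "((\<lambda>x. s * (\<phi>2 x / (\<phi>1 x)\<^sup>2)) has_integral (- (s * (1 / \<phi>1 b)) - - (s * (1 / \<phi>1 a)))) {a..b}"
    proof (rule fundamental_theorem_of_calculus[OF ab])
      fix x assume "x \<in> {a..b}"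
      from DERIV_minus[OF DERIV_cmult[OF dinv[OF this], of s]]
      show "((\<lambda>x. - (s * (1 / \<phi>1 x))) has_vector_derivative s * (\<phi>2 x / (\<phi>1 x)\<^sup>2)) (at x within {a..b})"
        by (simp add: has_real_derivative_iff_has_vector_derivative)
    qed
    have "cmod (integral {a..b} r) \<le> integral {a..b} (\<lambda>x. s * (\<phi>2 x / (\<phi>1 x)\<^sup>2))"
    proof (rule integral_norm_bound_integral[OF ri has_integral_integrable[OF I]])
      fix x assume x: "x \<in> {a..b}"
      have "\<bar>\<phi>2 x\<bar> = s * \<phi>2 x"
        using sgn(1) sgn(2)[OF x] by (metis abs_mult abs_of_nonneg mult_1)
      then show "cmod (r x) \<le> s * (\<phi>2 x / (\<phi>1 x)\<^sup>2)"
        by (simp add: r_def norm_mult norm_divide norm_power)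
    qed
    also have "\<dots> = - (s * (1 / \<phi>1 b)) + s * (1 / \<phi>1 a)"
      using I by (simp add: integral_unique)
    also have "\<dots> \<le> \<bar>s * (1 / \<phi>1 b)\<bar> + \<bar>s * (1 / \<phi>1 a)\<bar>"
      by linarith
    also have "\<dots> \<le> 2 / \<mu>"
      using inv[of a] inv[of b] ab sgn(1) unfolding abs_mult by simp
    finally show ?thesis .
  qed
  finally show ?thesis by simp
qed

text \<open>As \<open>\<phi>1\<close> grows at rate at least \<open>\<mu>\<close>, it is small only
  near one point \<open>c\<close>. A window around \<open>c\<close> is estimated by its length, the
  two sides by the first derivative test: 2 r + 4 r + 4 r.\<close>

lemma van_der_Corput_second_pos:
  fixes \<phi> \<phi>1 \<phi>2 :: "real \<Rightarrow> real"
  assumes ab: "a \<le> b"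
    and d1: "\<And>x. x \<in> {a..b} \<Longrightarrow> (\<phi> has_real_derivative \<phi>1 x) (at x within {a..b})"
    and d2: "\<And>x. x \<in> {a..b} \<Longrightarrow> (\<phi>1 has_real_derivative \<phi>2 x) (at x within {a..b})"
    and cont: "continuous_on {a..b} \<phi>2"
    and lam: "\<mu> > 0" "\<And>x. x \<in> {a..b} \<Longrightarrow> \<phi>2 x \<ge> \<mu>"
  shows "cmod (integral {a..b} (\<lambda>x. cis (\<phi> x))) \<le> 10 / sqrt \<mu>"
proof -
  have c0: "continuous_on {a..b} \<phi>" and c1: "continuous_on {a..b} \<phi>1"
    by (rule DERIV_continuous_on[OF d1] DERIV_continuous_on[OF d2]; assumption)+
  have incr: "\<phi>1 y - \<phi>1 x \<ge> \<mu> * (y - x)" if xy: "x \<in> {a..b}" "y \<in> {a..b}" "x \<le> y" for x y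
  proof -
    have sub: "{x..y} \<subseteq> {a..b}" using xy by auto
    obtain w where w: "w \<in> {x..y}" "\<phi>1 y - \<phi>1 x = \<phi>2 w * (y - x)"
    proof (rule mvt_very_simple[of x y \<phi>1 "\<lambda>w. (*) (\<phi>2 w)", THEN bexE])
      show "(\<phi>1 has_derivative (*) (\<phi>2 w)) (at w within {x..y})" if "x \<le> w" "w \<le> y" for w
        using DERIV_subset[OF d2 sub, of w] that sub by (auto simp: has_field_derivative_def)
    qed (use xy in auto)
    have "\<mu> \<le> \<phi>2 w" using lam(2) w(1) sub by blast
    then show ?thesis
      unfolding w(2) using \<open>x \<le> y\<close> by (intro mult_right_mono) auto
  qed
  obtain c where c: "c \<in> {a..b}" "\<And>x. x \<in> {a..b} \<Longrightarrow> \<bar>\<phi>1 x\<bar> \<ge> \<mu> * \<bar>x - c\<bar>"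
  proof -
    \<comment> \<open>Either a zero of \<open>\<phi>1\<close>, or the endpoint beyond which a zero
      would lie; the disjunctions let all cases share one estimate.\<close>
    have "\<exists>c\<in>{a..b}. (c = a \<or> \<phi>1 c \<le> 0) \<and> (c = b \<or> \<phi>1 c \<ge> 0)"
    proof (cases "\<phi>1 a \<ge> 0 \<or> \<phi>1 b \<le> 0")
      case True
      then show ?thesis using ab by force
    next
      case False
      then obtain c where "a \<le> c" "c \<le> b" "\<phi>1 c = 0"
        using IVT'[of \<phi>1 a 0 b] ab c1 by auto
      then show ?thesis by (intro bexI[of _ c]) auto
    qed
    then obtain c where c: "c \<in> {a..b}" "c = a \<or> \<phi>1 c \<le> 0" "c = b \<or> \<phi>1 c \<ge> 0" by blast
    have "\<bar>\<phi>1 x\<bar> \<ge> \<mu> * \<bar>x - c\<bar>" if x: "x \<in> {a..b}" for x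
    proof (cases "x \<ge> c")
      case True
      show ?thesis
      proof (cases "c = b")
        case True
        then show ?thesis using \<open>x \<ge> c\<close> x by simp
      next
        case False
        then show ?thesis using incr[of c x] c x True by force
      qed
    next
      case False
      have "c \<noteq> a" using False x by auto
      then show ?thesis using incr[of x c] c x False by (force simp: algebra_simps)
    qed
    with c(1) that show ?thesis by blast
  qed
  \<comment> \<open>Balances the window length \<open>2 * r\<close> against the side bound
    \<open>4 / (\<mu> * r)\<close>.\<close>
  define r where "r = 1 / sqrt \<mu>"
  have r: "r > 0" "\<mu> * r = sqrt \<mu>" "4 / sqrt \<mu> = 4 * r" "10 / sqrt \<mu> = 10 * r"
    using lam(1) by (auto simp: r_def real_div_sqrt)
  define p where "p = max a (c - r)"
  define q where "q = min b (c + r)"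
  have pq: "a \<le> p" "p \<le> q" "q \<le> b" "q - p \<le> 2 * r" 
    using r c(1) by (auto simp: p_def q_def)
  let ?f = "\<lambda>x. cis (\<phi> x)"
  have fi: "?f integrable_on {u..v}" if "{u..v} \<subseteq> {a..b}" for u v
    by (intro integrable_continuous_real continuous_on_cis continuous_on_subset[OF c0 that])
  have side: "cmod (integral {u..v} ?f) \<le> 4 * r"
    if uv: "{u..v} \<subseteq> {a..b}" "u \<le> v" and far: "\<And>x. x \<in> {u..v} \<Longrightarrow> \<bar>x - c\<bar> \<ge> r" for u v
    unfolding r(3) [symmetric]
  proof (rule van_der_Corput_first[where s = 1 and ?\<phi>1.0 = \<phi>1 and ?\<phi>2.0 = \<phi>2])
    fix x assume x: "x \<in> {u..v}"
    show "(\<phi> has_real_derivative \<phi>1 x) (at x within {u..v})"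
      by (rule DERIV_subset[OF d1 uv(1)]) (use x uv in auto)
    show "(\<phi>1 has_real_derivative \<phi>2 x) (at x within {u..v})"
      by (rule DERIV_subset[OF d2 uv(1)]) (use x uv in auto)
    show "0 \<le> 1 * \<phi>2 x" using lam(1) lam(2)[of x] x uv by auto
    have "sqrt \<mu> \<le> \<mu> * \<bar>x - c\<bar>"
      using far[OF x] lam(1) unfolding r(2) [symmetric] by simp
    also have "\<dots> \<le> \<bar>\<phi>1 x\<bar>" using c(2) x uv by blast
    finally show "sqrt \<mu> \<le> \<bar>\<phi>1 x\<bar>" .
  qed (use lam uv continuous_on_subset[OF cont uv(1)] in auto)
  have 1: "cmod (integral {a..p} ?f) \<le> 4 * r"
  proof (cases "p = a")
    case False
    then have "p = c - r" "a \<le> p" by (auto simp: p_def)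
    then show ?thesis using pq by (intro side) auto
  qed (use r in auto)
  have 3: "cmod (integral {q..b} ?f) \<le> 4 * r"
  proof (cases "q = b")
    case False
    then have "q = c + r" "q \<le> b" by (auto simp: q_def)
    then show ?thesis using pq by (intro side) auto
  qed (use r in auto)
  have "cmod (integral {p..q} ?f) \<le> integral {p..q} (\<lambda>_. 1)"
    using pq by (intro integral_norm_bound_integral fi) auto
  then have 2: "cmod (integral {p..q} ?f) \<le> 2 * r"
    using pq by simp
  have "integral {a..b} ?f = integral {a..p} ?f + integral {p..b} ?f"
    using pq by (intro Henstock_Kurzweil_Integration.integral_combine [symmetric] fi) auto
  also have "integral {p..b} ?f = integral {p..q} ?f + integral {q..b} ?f"
    using pq by (intro Henstock_Kurzweil_Integration.integral_combine [symmetric] fi) auto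
  finally have "cmod (integral {a..b} ?f) \<le> 4 * r + (2 * r + 4 * r)"
    using 1 2 3 by (simp only:) (intro norm_triangle_le add_mono)
  then show ?thesis using r by simp
qed

lemma van_der_Corput_second:
  fixes \<phi> \<phi>1 \<phi>2 :: "real \<Rightarrow> real"
  assumes ab: "a \<le> b"
    and d1: "\<And>x. x \<in> {a..b} \<Longrightarrow> (\<phi> has_real_derivative \<phi>1 x) (at x within {a..b})"
    and d2: "\<And>x. x \<in> {a..b} \<Longrightarrow> (\<phi>1 has_real_derivative \<phi>2 x) (at x within {a..b})"
    and cont: "continuous_on {a..b} \<phi>2"
    and s: "\<bar>s\<bar> = 1"
    and lam: "\<mu> > 0" "\<And>x. x \<in> {a..b} \<Longrightarrow> s * \<phi>2 x \<ge> \<mu>"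
  shows "cmod (integral {a..b} (\<lambda>x. cis (\<phi> x))) \<le> 10 / sqrt \<mu>"
proof (cases "s = 1")
  case True
  then show ?thesis using van_der_Corput_second_pos[OF ab d1 d2 cont lam(1)] lam(2) by simp
next
  case False
  then have "s = -1" using s by auto
  have "cmod (integral {a..b} (\<lambda>x. cis (- \<phi> x))) \<le> 10 / sqrt \<mu>"
    using lam \<open>s = -1\<close>
    by (intro van_der_Corput_second_pos[where ?\<phi>1.0 = "\<lambda>x. - \<phi>1 x" and ?\<phi>2.0 = "\<lambda>x. - \<phi>2 x"]
        ab d1 d2 cont DERIV_minus continuous_intros) auto
  also have "integral {a..b} (\<lambda>x. cis (- \<phi> x)) = cnj (integral {a..b} (\<lambda>x. cis (\<phi> x)))"
    by (simp add: integral_cnj cis_cnj)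
  finally show ?thesis by simp
qed

section \<open>Fourier coefficients along the curve and the weights of the criterion\<close>

definition freq_weight :: "int \<Rightarrow> int \<Rightarrow> real" where
  "freq_weight l k = 1 / (real_of_int (maxnorm (l, k))) powr (3/2)
     + 1 / ((1 + real_of_int \<bar>l\<bar>) * (1 + real_of_int \<bar>k\<bar>))"

definition curve_integral :: "(real \<Rightarrow> real) \<Rightarrow> real \<Rightarrow> int \<Rightarrow> int \<Rightarrow> complex" where
  "curve_integral g t l k = integral {0..t} (\<lambda>y. cis (- (2 * pi * (of_int l * y + of_int k * g y))))"

text \<open>Fourier coefficients of \<open>saw\<close>. The value at \<open>k = 0\<close> expresses
  mean zero and removes all frequencies \<open>(l, 0)\<close> from the curve sums.\<close>

definition saw_coeff :: "int \<Rightarrow> complex" where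
  "saw_coeff k = (if k = 0 then 0 else \<i> / (2 * pi * of_int k))"

lemma norm_saw_coeff: "k \<noteq> 0 \<Longrightarrow> cmod (saw_coeff k) = 1 / (2 * pi * \<bar>of_int k\<bar>)"
  by (simp add: saw_coeff_def norm_divide norm_mult)

lemma norm_saw_coeff_le:
  assumes "k \<noteq> 0"
  shows "cmod (saw_coeff k) \<le> 1 / (1 + \<bar>of_int k\<bar>)"
proof -
  have k: "\<bar>real_of_int k\<bar> \<ge> 1" using assms by linarith
  have "2 * 1 * \<bar>real_of_int k\<bar> \<le> 2 * pi * \<bar>of_int k\<bar>"
    using pi_gt3 by (intro mult_right_mono mult_left_mono) auto
  then have "1 + \<bar>of_int k\<bar> \<le> 2 * pi * \<bar>real_of_int k\<bar>" using k by linarith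
  then show ?thesis
    unfolding norm_saw_coeff[OF assms] using k by (intro divide_left_mono) auto
qed

lemma has_integral_saw_coeff:
  "((\<lambda>y. cis (- (2 * pi * (of_int k * y))) * of_real (saw y)) has_integral saw_coeff k) {0..1}"
proof (rule has_integral_spike[of "{1}"])
  let ?f = "\<lambda>y::real. cis (- (2 * pi * (of_int k * y))) * of_real (y - 1/2)"
  show "(?f has_integral saw_coeff k) {0..1}"
  proof (cases "k = 0")
    case True
    have "((\<lambda>y. y - 1/2) has_integral ((1::real)\<^sup>2 / 2 - 1/2 * 1) - (0\<^sup>2 / 2 - 1/2 * 0)) {0..1}"
      by (rule fundamental_theorem_of_calculus)
         (auto intro!: derivative_eq_intros simp flip: has_real_derivative_iff_has_vector_derivative)
    then have "((\<lambda>y. complex_of_real (y - 1/2)) has_integral 0) {0..1}"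
      using has_integral_of_real[of "\<lambda>y. y - 1/2" 0 "{0..1}", where ?'b = complex]
      by (simp only: of_real_0) (simp add: power2_eq_square)
    then show ?thesis using True by (simp add: saw_coeff_def)
  next
    case False
    define al where "al = complex_of_real (- (2 * pi * of_int k)) * \<i>"
    have al: "al \<noteq> 0" using False by (simp add: al_def)
    let ?c = "\<lambda>y::real. cis (- (2 * pi * (of_int k * y)))"
    let ?F = "\<lambda>y::real. ?c y * of_real (y - 1/2) / al - ?c y / al\<^sup>2"
    have "(?f has_integral (?F 1 - ?F 0)) {0..1}"
    proof (rule fundamental_theorem_of_calculus)
      fix y :: real
      have "((\<lambda>y. - (2 * pi * (of_int k * y))) has_real_derivative - (2 * pi * of_int k)) (at y within {0..1})"
        by (auto intro!: derivative_eq_intros)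
      note c = has_vector_derivative_cis_comp[OF this]
      have "((\<lambda>y. y - 1/2) has_real_derivative 1) (at y within {0..1})"
        by (auto intro!: derivative_eq_intros)
      note l = has_vector_derivative_of_real[OF this, where ?'a = complex]
      show "(?F has_vector_derivative ?f y) (at y within {0..1})"
        by (rule has_vector_derivative_eq_rhs[OF has_vector_derivative_diff[OF
            has_vector_derivative_divide[OF has_vector_derivative_mult[OF c l], of al]
            has_vector_derivative_divide[OF c, of "al\<^sup>2"]]])
           (use al in \<open>simp add: al_def field_simps power2_eq_square\<close>)
    qed auto
    moreover have "?c 1 = 1"
      using cis_multiple_2pi[of "- of_int k"] by simp
    then have "?F 1 - ?F 0 = saw_coeff k"
      using al False by (simp add: saw_coeff_def al_def field_simps)
    ultimately show ?thesis by simp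
  qed
qed (auto simp: saw_def frac_eq_id)

text \<open>For the flat curve the phase is linear, so the first derivative test with constant
  slope, or the trivial bound at \<open>l = 0\<close>, yields the product part of the
  weight.\<close>

lemma curve_integral_zero_bound:
  assumes t: "t \<in> {0..1}" and k: "k \<noteq> 0"
  shows "cmod (saw_coeff k) * cmod (curve_integral (\<lambda>_. 0) t l k) \<le> 4 * freq_weight l k"
proof -
  have "cmod (curve_integral (\<lambda>_. 0) t l k) \<le> 4 / (1 + \<bar>of_int l\<bar>)"
  proof (cases "l = 0")
    case True
    then show ?thesis using t by (simp add: curve_integral_def)
  next
    case False
    then have l: "\<bar>real_of_int l\<bar> \<ge> 1" by linarith
    have "cmod (curve_integral (\<lambda>_. 0) t l k) \<le> 4 / (2 * pi * \<bar>of_int l\<bar>)"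
      unfolding curve_integral_def using t l
      by (intro van_der_Corput_first[where s = 1 and ?\<phi>1.0 = "\<lambda>_. - (2 * pi * of_int l)" and ?\<phi>2.0 = "\<lambda>_. 0"])
         (auto intro!: derivative_eq_intros simp: abs_mult)
    also have "\<dots> \<le> 4 / (1 + \<bar>of_int l\<bar>)"
    proof (intro divide_left_mono)
      have "2 * 1 * \<bar>real_of_int l\<bar> \<le> 2 * pi * \<bar>of_int l\<bar>"
        using pi_gt3 by (intro mult_right_mono mult_left_mono) auto
      then show "1 + \<bar>of_int l\<bar> \<le> 2 * pi * \<bar>real_of_int l\<bar>" using l by linarith
    qed (use l in auto)
    finally show ?thesis .
  qed
  moreover have "cmod (saw_coeff k) \<le> 1 / (1 + \<bar>of_int k\<bar>)"
    using norm_saw_coeff_le[OF k] .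
  ultimately have "cmod (saw_coeff k) * cmod (curve_integral (\<lambda>_. 0) t l k) \<le>
      1 / (1 + \<bar>of_int k\<bar>) * (4 / (1 + \<bar>of_int l\<bar>))"
    by (intro mult_mono) auto
  also have "\<dots> = 4 * (1 / ((1 + real_of_int \<bar>l\<bar>) * (1 + real_of_int \<bar>k\<bar>)))"
    by (simp add: field_simps)
  also have "\<dots> \<le> 4 * freq_weight l k"
    unfolding freq_weight_def by simp
  finally show ?thesis .
qed

text \<open>The two summands of \<open>freq_weight\<close> mirror two regimes. If |l| is at least 2
  Lam |k|, the phase has no stationary point and the first test gives the product term. Otherwise
  \<open>maxnorm (l, k)\<close> is at most 2 Lam |k|, and |k|^(-1/2) from the second test joins
  1/|k| to form the exponent 3/2.\<close>

lemma curve_integral_bound: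
  fixes g g' g'' :: "real \<Rightarrow> real"
  assumes d1: "\<And>z. z \<in> {0..1} \<Longrightarrow> (g has_real_derivative g' z) (at z within {0..1})"
    and d2: "\<And>z. z \<in> {0..1} \<Longrightarrow> (g' has_real_derivative g'' z) (at z within {0..1})"
    and cont: "continuous_on {0..1} g''"
    and Lam: "Lam \<ge> 1" "\<And>z. z \<in> {0..1} \<Longrightarrow> \<bar>g' z\<bar> \<le> Lam"
    and m: "m > 0" "\<bar>s\<bar> = 1" "\<And>z. z \<in> {0..1} \<Longrightarrow> s * g'' z \<ge> m"
    and t: "t \<in> {0..1}" and k: "k \<noteq> 0"
  shows "cmod (saw_coeff k) * cmod (curve_integral g t l k)
    \<le> (4 + 10 / sqrt m * (2 * Lam) powr (3/2)) * freq_weight l k"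
proof -
  let ?\<phi> = "\<lambda>y. - (2 * pi * (of_int l * y + of_int k * g y))"
  let ?\<phi>1 = "\<lambda>y. - (2 * pi * (of_int l + of_int k * g' y))"
  let ?\<phi>2 = "\<lambda>y. - (2 * pi * (of_int k * g'' y))"
  have sub: "{0..t} \<subseteq> {0..1}" using t by auto
  have D1: "(?\<phi> has_real_derivative ?\<phi>1 x) (at x within {0..t})" if "x \<in> {0..t}" for x
    by (rule DERIV_subset[OF _ sub]) (use that t in \<open>auto intro!: derivative_eq_intros d1\<close>)
  have D2: "(?\<phi>1 has_real_derivative ?\<phi>2 x) (at x within {0..t})" if "x \<in> {0..t}" for x
    by (rule DERIV_subset[OF _ sub]) (use that t in \<open>auto intro!: derivative_eq_intros d2\<close>)
  have C: "continuous_on {0..t} ?\<phi>2"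
    by (intro continuous_intros continuous_on_subset[OF cont sub])
  have k1: "\<bar>real_of_int k\<bar> \<ge> 1" using k by linarith
  have nn: "freq_weight l k \<ge> 0" by (simp add: freq_weight_def)
  \<comment> \<open>The constant sign of the second derivative of the phase, which is a positive
    multiple of \<open>- k * g''\<close>.\<close>
  define sk where "sk = - s * sgn (of_int k)"
  have sk: "\<bar>sk\<bar> = 1" using m(2) k by (simp add: sk_def abs_mult abs_sgn_eq)
  have sk2: "sk * ?\<phi>2 x \<ge> 2 * pi * \<bar>of_int k\<bar> * m" if "x \<in> {0..t}" for x
  proof -
    have "sk * ?\<phi>2 x = 2 * pi * \<bar>of_int k\<bar> * (s * g'' x)"
      by (simp add: sk_def abs_sgn)
    also have "\<dots> \<ge> 2 * pi * \<bar>of_int k\<bar> * m"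
      using m(3)[of x] that t by (intro mult_left_mono) auto
    finally show ?thesis .
  qed
  have km: "2 * pi * \<bar>real_of_int k\<bar> * m > 0" using k m(1) by simp
  show ?thesis
  proof (cases "\<bar>real_of_int l\<bar> \<ge> 2 * Lam * \<bar>of_int k\<bar>")
    case True
    have "2 * 1 * 1 \<le> 2 * Lam * \<bar>real_of_int k\<bar>"
      using Lam(1) k1 by (intro mult_mono) auto
    then have l: "\<bar>real_of_int l\<bar> \<ge> 2" using True by linarith
    have "cmod (curve_integral g t l k) \<le> 4 / (pi * \<bar>of_int l\<bar>)"
      unfolding curve_integral_def
    proof (rule van_der_Corput_first[where s = sk, OF _ D1 D2 C sk])
      fix x assume x: "x \<in> {0..t}"
      show "0 \<le> sk * ?\<phi>2 x"
        using sk2[OF x] km by linarith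
      have "\<bar>of_int k * g' x\<bar> \<le> \<bar>of_int k\<bar> * Lam"
        unfolding abs_mult using Lam(2)[of x] x t by (intro mult_left_mono) auto
      then have "2 * \<bar>of_int k * g' x\<bar> \<le> \<bar>real_of_int l\<bar>"
        using True by (simp add: mult_ac)
      then have "\<bar>of_int l + of_int k * g' x\<bar> \<ge> \<bar>real_of_int l\<bar> / 2"
        by linarith
      then have "2 * pi * (\<bar>real_of_int l\<bar> / 2) \<le> 2 * pi * \<bar>of_int l + of_int k * g' x\<bar>"
        by (intro mult_left_mono) auto
      then show "pi * \<bar>of_int l\<bar> \<le> \<bar>?\<phi>1 x\<bar>"
        by (simp add: abs_mult)
    qed (use t l in auto)
    also have "\<dots> \<le> 4 / (1 + \<bar>of_int l\<bar>)"
    proof (intro divide_left_mono)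
      have "2 * \<bar>real_of_int l\<bar> \<le> pi * \<bar>of_int l\<bar>"
        using pi_gt3 by (intro mult_right_mono) auto
      then show "1 + \<bar>of_int l\<bar> \<le> pi * \<bar>real_of_int l\<bar>" using l by linarith
    qed (use l in auto)
    finally have "cmod (saw_coeff k) * cmod (curve_integral g t l k) \<le>
        1 / (1 + \<bar>of_int k\<bar>) * (4 / (1 + \<bar>of_int l\<bar>))"
      using norm_saw_coeff_le[OF k] by (intro mult_mono) auto
    also have "\<dots> = 4 * (1 / ((1 + real_of_int \<bar>l\<bar>) * (1 + real_of_int \<bar>k\<bar>)))"
      by (simp add: field_simps)
    also have "\<dots> \<le> 4 * freq_weight l k"
      unfolding freq_weight_def by simp
    also have "\<dots> \<le> (4 + 10 / sqrt m * (2 * Lam) powr (3/2)) * freq_weight l k"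
      using nn m(1) by (intro mult_right_mono) auto
    finally show ?thesis .
  next
    case False
    let ?k = "\<bar>real_of_int k\<bar>"
    have "cmod (curve_integral g t l k) \<le> 10 / sqrt (2 * pi * ?k * m)"
      unfolding curve_integral_def
      using van_der_Corput_second[OF _ D1 D2 C sk km sk2] t by simp
    also have "\<dots> \<le> 10 / sqrt (?k * m)"
    proof (intro divide_left_mono real_sqrt_le_mono)
      show "?k * m \<le> 2 * pi * ?k * m"
        using mult_right_mono[of 1 "2 * pi" "?k * m"] pi_gt3 m(1) by simp
    qed (use km m(1) k1 in auto)
    finally have "cmod (curve_integral g t l k) \<le> 10 / sqrt (?k * m)" .
    moreover have "cmod (saw_coeff k) \<le> 1 / ?k"
      using norm_saw_coeff_le[OF k] k1 by (elim order_trans) (intro divide_left_mono, auto)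
    ultimately have "cmod (saw_coeff k) * cmod (curve_integral g t l k) \<le> 1 / ?k * (10 / sqrt (?k * m))"
      using m(1) by (intro mult_mono) auto
    also have "\<dots> = 10 / sqrt m * (1 / ?k powr (3/2))"
    proof -
      have "?k powr (3/2) = ?k powr 1 * ?k powr (1/2)"
        unfolding powr_add [symmetric] by simp
      then show ?thesis
        using k1 by (simp add: powr_half_sqrt real_sqrt_mult)
    qed
    also have "1 / ?k powr (3/2) \<le> (2 * Lam) powr (3/2) * (1 / (real_of_int (maxnorm (l, k))) powr (3/2))"
    proof -
      have n: "real_of_int (maxnorm (l, k)) \<le> 2 * Lam * ?k" "real_of_int (maxnorm (l, k)) > 0"
      proof -
        have "1 * ?k \<le> 2 * Lam * ?k"
          using Lam(1) by (intro mult_right_mono) auto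
        then show "real_of_int (maxnorm (l, k)) \<le> 2 * Lam * ?k"
          using False by (auto simp: maxnorm_def max_def)
        show "real_of_int (maxnorm (l, k)) > 0"
          using k by (auto simp: maxnorm_def)
      qed
      have "(real_of_int (maxnorm (l, k))) powr (3/2) \<le> (2 * Lam * ?k) powr (3/2)"
        using n by (intro powr_mono2) auto
      also have "\<dots> = (2 * Lam) powr (3/2) * ?k powr (3/2)"
        using Lam(1) by (simp add: powr_mult)
      finally show ?thesis
        using n k1 by (simp add: field_simps)
    qed
    finally have "cmod (saw_coeff k) * cmod (curve_integral g t l k) \<le>
        (10 / sqrt m * (2 * Lam) powr (3/2)) * (1 / (real_of_int (maxnorm (l, k))) powr (3/2))"
      using m(1) by (simp add: mult_left_mono divide_right_mono)
    also have "\<dots> \<le> (10 / sqrt m * (2 * Lam) powr (3/2)) * freq_weight l k"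
      unfolding freq_weight_def using m(1) by (intro mult_left_mono) auto
    also have "\<dots> \<le> (4 + 10 / sqrt m * (2 * Lam) powr (3/2)) * freq_weight l k"
      using nn by (intro mult_right_mono) auto
    finally show ?thesis .
  qed
qed

subsection \<open>Smoothing\<close>

lemma has_integral_of_real_complex:
  assumes "((\<lambda>z. complex_of_real (f z)) has_integral I) S"
  shows "(f has_integral Re I) S" and "of_real (Re I) = I"
proof -
  show "(f has_integral Re I) S"
    using has_integral_linear[OF assms bounded_linear_Re] by (simp add: o_def)
  have "((\<lambda>z. 0::real) has_integral Im I) S"
    using has_integral_linear[OF assms bounded_linear_Im] by (simp add: o_def)
  then have "Im I = 0"
    using has_integral_unique has_integral_0 by blast
  then show "of_real (Re I) = I"
    by (simp add: complex_eq_iff)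
qed

text \<open>The Fejer mean of \<open>saw\<close>. The sum is itself real, so \<open>Re\<close> only
  changes the type.\<close>

definition smooth_saw :: "nat \<Rightarrow> real \<Rightarrow> real" where
  "smooth_saw K u = Re (\<Sum>k\<in>freqs K. of_real (fejer_coeff K k) * (cis (2 * pi * (of_int k * u)) * saw_coeff k))"

lemma smooth_saw:
  shows has_integral_smooth_saw:
      "((\<lambda>z. fejer K z * saw (u - z)) has_integral smooth_saw K u) {-(1/2)..1/2}"
    and smooth_saw_expand: "complex_of_real (smooth_saw K u) =
      (\<Sum>k\<in>freqs K. of_real (fejer_coeff K k) * (cis (2 * pi * (of_int k * u)) * saw_coeff k))"
proof -
  have "((\<lambda>z. complex_of_real (fejer K z * saw (u - z))) has_integral
      (\<Sum>k\<in>freqs K. of_real (fejer_coeff K k) * (cis (2 * pi * (of_int k * u)) * saw_coeff k))) {-(1/2)..1/2}"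
    using fejer_convolution[of K "\<lambda>y. of_real (saw y)" saw_coeff u] has_integral_saw_coeff
    by (simp add: saw_frac)
  from has_integral_of_real_complex[OF this] show
    "((\<lambda>z. fejer K z * saw (u - z)) has_integral smooth_saw K u) {-(1/2)..1/2}"
    "complex_of_real (smooth_saw K u) =
      (\<Sum>k\<in>freqs K. of_real (fejer_coeff K k) * (cis (2 * pi * (of_int k * u)) * saw_coeff k))"
    by (simp_all add: smooth_saw_def)
qed

text \<open>The extremal argument behind the Erdos--Turan inequality: near a point where \<open>\<bar>E\<bar>\<close> almost
  attains its supremum \<open>D\<close>, an average of \<open>E\<close> is at least \<open>D/2\<close> up to the local variation \<open>\<eta>\<close>.\<close>
lemma abs_le_if_averages_le:
  fixes E :: "'a \<Rightarrow> real"
  assumes bdd: "\<And>p. \<bar>E p\<bar> \<le> 1"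
    and nonneg: "B \<ge> 0" "\<eta> \<ge> 0"
    and avg: "\<And>p s D A. \<bar>s\<bar> = 1 \<Longrightarrow> (\<And>q. \<bar>E q\<bar> \<le> D) \<Longrightarrow> A \<le> s * E p - \<eta> \<Longrightarrow> - D \<le> A
      \<Longrightarrow> - D + (A + D) * (3/4) \<le> B"
  shows "\<bar>E p\<bar> \<le> 2 * B + 2 * \<eta>"
proof -
  define D where "D = (SUP p. \<bar>E p\<bar>)"
  have bdd': "bdd_above (range (\<lambda>p. \<bar>E p\<bar>))"
    using bdd by (intro bdd_aboveI[of _ 1]) auto
  have D: "\<bar>E q\<bar> \<le> D" for q
    unfolding D_def by (intro cSUP_upper bdd') auto
  \<comment> \<open>\<open>E\<close> may jump and need not attain its supremum, hence the slack
    \<open>e\<close>.\<close>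
  have "D \<le> 2 * B + 2 * \<eta> + e" if "e > 0" for e
  proof -
    obtain p where p: "\<bar>E p\<bar> > D - e / 2"
      using less_cSUP_iff[OF _ bdd', of "D - e / 2"] \<open>e > 0\<close> by (auto simp: D_def)
    define s where "s = (if E p \<ge> 0 then 1 else - 1 :: real)"
    have s: "\<bar>s\<bar> = 1" "s * E p = \<bar>E p\<bar>"
      by (auto simp: s_def)
    let ?A = "D - e / 2 - \<eta>"
    show ?thesis
    proof (cases "- D \<le> ?A")
      case True
      \<comment> \<open>The left side equals \<open>D / 2 - 3 * e / 8 - 3 * \<eta> / 4\<close>: the
        weight 3/4 leaves a positive multiple of \<open>D\<close>.\<close>
      have "- D + (?A + D) * (3/4) \<le> B"
        using p s by (intro avg[OF s(1) D _ True, of p]) auto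
      then show ?thesis using nonneg \<open>e > 0\<close> by (simp add: field_simps)
    next
      case False
      then show ?thesis using nonneg \<open>e > 0\<close> by linarith
    qed
  qed
  then have "D \<le> 2 * B + 2 * \<eta>"
    by (rule field_le_epsilon)
  then show ?thesis using D[of p] by linarith
qed

text \<open>The Erdos-Turan inequality in sawtooth form. It serves the strip counts near the
  vertical edges as well as the Koksma step.\<close>

lemma saw_sum_bound:
  fixes a :: "nat \<Rightarrow> real"
  assumes K: "K \<ge> 8" and M: "M \<ge> 1"
  shows "\<bar>(\<Sum>j<M. saw (a j - w)) / M\<bar> \<le>
    2 * (\<Sum>k\<in>freqs K. cmod (saw_coeff k) * cmod ((1 / of_nat M) * (\<Sum>j<M. cis (2 * pi * (of_int k * a j)))))
      + 16 / K"
proof -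
  define E where "E w = (\<Sum>j<M. saw (a j - w)) / M" for w
  define B where "B = (\<Sum>k\<in>freqs K. cmod (saw_coeff k) *
      cmod ((1 / of_nat M) * (\<Sum>j<M. cis (2 * pi * (of_int k * a j)))))"
  have "\<bar>E w\<bar> \<le> 2 * B + 2 * (8 / K)" for w
  proof (rule abs_le_if_averages_le[where E = E])
    show "\<bar>E p\<bar> \<le> 1" for p
    proof -
      have "\<bar>\<Sum>j<M. saw (a j - p)\<bar> \<le> (\<Sum>j<M. \<bar>saw (a j - p)\<bar>)"
        by (rule sum_abs)
      also have "\<dots> \<le> (\<Sum>j<M. 1)"
        by (intro sum_mono order_trans[OF saw_bound]) auto
      finally show ?thesis using M by (simp add: E_def)
    qed
    show "0 \<le> B" unfolding B_def by (intro sum_nonneg) auto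
    show "0 \<le> 8 / real K" by simp
    fix p s D A :: real
    assume s: "\<bar>s\<bar> = 1" and D: "\<And>q. \<bar>E q\<bar> \<le> D" and A: "A \<le> s * E p - 8 / K" "- D \<le> A"
    \<comment> \<open>The centre moves by one window radius in the direction in which no jump can
      lower \<open>s * saw\<close>. Over the whole window the displacement from \<open>p\<close>
      then stays between 0 and \<open>8 / K\<close> in that direction.\<close>
    define v where "v = p + s * (4 / K)"
    define I where "I = (\<Sum>j<M. smooth_saw K (a j - v)) / M"
    have I: "((\<lambda>z. fejer K z * (s * E (v + z))) has_integral s * I) {-(1/2)..1/2}"
    proof -
      have "((\<lambda>z. s * ((\<Sum>j<M. fejer K z * saw (a j - v - z)) / M)) has_integral s * I) {-(1/2)..1/2}"
        unfolding I_def
        by (intro has_integral_mult_right has_integral_divide has_integral_sum has_integral_smooth_saw) auto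
      then show ?thesis
        by (simp add: E_def sum_distrib_left diff_diff_eq mult_ac)
    qed
    have near: "s * E (v + z) \<ge> A" if z: "\<bar>z\<bar> \<le> 4 / K" for z
    proof -
      have "s * saw (a j - (v + z)) \<ge> s * saw (a j - p) - 8 / K" for j
      proof (cases "s = 1")
        case True
        have "saw (a j - p - (4 / K + z)) \<ge> saw (a j - p) - (4 / K + z)"
          using z by (intro saw_diff_ge) linarith
        then show ?thesis using True z by (simp add: v_def algebra_simps)
      next
        case False
        then have "s = -1" using s by auto
        have "saw (a j - p + (4 / K - z)) \<le> saw (a j - p) + (4 / K - z)"
          using z by (intro saw_add_le) linarith
        then show ?thesis using \<open>s = -1\<close> z by (simp add: v_def algebra_simps)
      qed
      then have "(\<Sum>j<M. s * saw (a j - p) - 8 / K) \<le> (\<Sum>j<M. s * saw (a j - (v + z)))"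
        by (intro sum_mono)
      then have "(\<Sum>j<M. s * saw (a j - p) - 8 / K) / M \<le> (\<Sum>j<M. s * saw (a j - (v + z))) / M"
        by (rule divide_right_mono) simp
      then have "s * E p - 8 / K \<le> s * E (v + z)"
        using M by (simp add: E_def sum_subtractf diff_divide_distrib flip: sum_distrib_left)
      then show ?thesis using A by linarith
    qed
    have "- D + (A + D) * (7/8) \<le> s * I"
    proof (rule fejer_average_ge[OF K I _ near A(2)])
      show "- D \<le> s * E (v + z)" for z
        using D[of "v + z"] s by (auto simp: abs_if split: if_splits)
    qed auto
    moreover have "s * I \<le> B"
    proof -
      have "s * I \<le> \<bar>I\<bar>" using s by (auto simp: abs_if split: if_splits)
      also have "\<bar>I\<bar> = cmod (of_real I)" by simp
      also have "complex_of_real I = (\<Sum>k\<in>freqs K. of_real (fejer_coeff K k) * saw_coeff k *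
        cis (- (2 * pi * (of_int k * v))) * ((1 / of_nat M) * (\<Sum>j<M. cis (2 * pi * (of_int k * a j)))))"
      proof -
        have "complex_of_real I = (\<Sum>j<M. \<Sum>k\<in>freqs K. of_real (fejer_coeff K k) *
            (cis (2 * pi * (of_int k * (a j - v))) * saw_coeff k)) / M"
          by (simp add: I_def smooth_saw_expand)
        also have "\<dots> = (\<Sum>k\<in>freqs K. \<Sum>j<M. of_real (fejer_coeff K k) *
            (cis (2 * pi * (of_int k * (a j - v))) * saw_coeff k) / M)"
          by (subst sum.swap) (simp add: sum_divide_distrib)
        also have "\<dots> = (\<Sum>k\<in>freqs K. of_real (fejer_coeff K k) * saw_coeff k *
          cis (- (2 * pi * (of_int k * v))) * ((1 / of_nat M) * (\<Sum>j<M. cis (2 * pi * (of_int k * a j)))))"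
        proof (rule sum.cong[OF refl])
          fix k
          have "cis (2 * pi * (of_int k * (a j - v))) = cis (- (2 * pi * (of_int k * v))) * cis (2 * pi * (of_int k * a j))" for j
            by (simp add: cis_mult algebra_simps)
          then show "(\<Sum>j<M. of_real (fejer_coeff K k) *
              (cis (2 * pi * (of_int k * (a j - v))) * saw_coeff k) / M) =
            of_real (fejer_coeff K k) * saw_coeff k *
              cis (- (2 * pi * (of_int k * v))) * ((1 / of_nat M) * (\<Sum>j<M. cis (2 * pi * (of_int k * a j))))"
            by (simp add: sum_distrib_left mult_ac)
        qed
        finally show ?thesis .
      qed
      also have "cmod \<dots> \<le> B"
        unfolding B_def
      proof (rule sum_norm_le)
        fix k
        let ?S = "(1 / of_nat M) * (\<Sum>j<M. cis (2 * pi * (of_int k * a j)))"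
        have "cmod (of_real (fejer_coeff K k) * saw_coeff k * cis (- (2 * pi * (of_int k * v))) * ?S)
            = fejer_coeff K k * (cmod (saw_coeff k) * cmod ?S)"
          using fejer_coeff_nonneg[of K k] by (simp add: norm_mult norm_divide)
        also have "\<dots> \<le> 1 * (cmod (saw_coeff k) * cmod ?S)"
          by (intro mult_right_mono fejer_coeff_le_1) auto
        finally show "cmod (of_real (fejer_coeff K k) * saw_coeff k * cis (- (2 * pi * (of_int k * v))) * ?S)
            \<le> cmod (saw_coeff k) * cmod ?S" by simp
      qed
      finally show ?thesis .
    qed
    \<comment> \<open>A single convolution keeps 7/8; the weaker 3/4 is the form shared with the
      two-dimensional case.\<close>
    moreover have "(A + D) * (3/4) \<le> (A + D) * (7/8)"
      using A(2) by (intro mult_left_mono) auto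
    ultimately show "- D + (A + D) * (3/4) \<le> B"
      by linarith
  qed
  then show ?thesis by (simp add: E_def B_def)
qed

text \<open>A function on the torus: \<open>g\<close> and the cut-off at \<open>t\<close> are extended periodically from \<open>{0..<1}\<close>.\<close>
definition curve_saw :: "(real \<Rightarrow> real) \<Rightarrow> real \<Rightarrow> real \<Rightarrow> real \<Rightarrow> real" where
  "curve_saw g t a b = (if frac a < t then saw (b - g (frac a)) else 0)"

definition curve_avg :: "(real \<Rightarrow> real) \<Rightarrow> real \<Rightarrow> nat \<Rightarrow> (nat \<Rightarrow> real \<times> real) \<Rightarrow> real \<Rightarrow> real \<Rightarrow> real" where
  "curve_avg g t M x w1 w2 = (\<Sum>j<M. curve_saw g t (fst (x j) - w1) (snd (x j) - w2)) / M"

text \<open>Independent of translations, which only multiply each term by a phase; the Fejer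
  coefficients are replaced by their bound 1.\<close>

definition curve_exp_bound :: "nat \<Rightarrow> (real \<Rightarrow> real) \<Rightarrow> real \<Rightarrow> nat \<Rightarrow> (nat \<Rightarrow> real \<times> real) \<Rightarrow> real" where
  "curve_exp_bound K g t M x = (\<Sum>l\<in>freqs K. \<Sum>k\<in>freqs K.
     cmod (saw_coeff k) * cmod (curve_integral g t l k) * cmod (expsum M x (l, k)))"

lemma curve_saw_bound: "\<bar>curve_saw g t a b\<bar> \<le> 1/2"
  using saw_bound by (simp add: curve_saw_def)

lemma has_integral_curve_integral:
  assumes g: "continuous_on {0..1} g" and t: "t \<in> {0..1}"
  shows "((\<lambda>y. if y < t then cis (- (2 * pi * (of_int l * y + of_int k * g y))) else 0)
    has_integral curve_integral g t l k) {0..1}"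
proof (rule has_integral_spike[of "{t}"])
  let ?f = "\<lambda>y. cis (- (2 * pi * (of_int l * y + of_int k * g y)))"
  have sub: "{0..t} \<subseteq> {0..1}" using t by auto
  have "?f integrable_on {0..t}"
    by (intro integrable_continuous_real continuous_on_cis continuous_intros continuous_on_subset[OF g sub])
  then have "(?f has_integral curve_integral g t l k) {0..t}"
    unfolding curve_integral_def by (rule integrable_integral)
  then show "((\<lambda>y. if y \<in> {0..t} then ?f y else 0) has_integral curve_integral g t l k) {0..1}"
    by (simp only: has_integral_restrict[OF sub])
qed auto

lemma mult_regroup:
  fixes p q r u v w :: complex
  assumes "q * u = v * w"
  shows "p * (q * r) * u = v * (p * (w * r))"
proof -
  have "p * (q * r) * u = p * r * (q * u)" by (simp add: mult_ac)
  then show ?thesis by (simp add: assms mult_ac)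
qed

lemma mult_regroup_divide:
  fixes p q r u v w :: complex
  assumes "q * u = v * w"
  shows "p * (q * (r * (u * s) * J)) / m = p * r * s * J * v * (1 / m * w)"
proof -
  have "p * (q * (r * (u * s) * J)) / m = p * r * s * J * (q * u) / m" by (simp add: mult_ac)
  then show ?thesis by (simp add: assms mult_ac)
qed

text \<open>Smoothing first in the second coordinate turns \<open>saw\<close> into a trigonometric polynomial, whose
  dependence on the first coordinate is then smoothed to the integrals along the curve.\<close>
lemma curve_avg_smooth:
  fixes x :: "nat \<Rightarrow> real \<times> real"
  assumes g: "continuous_on {0..1} g" and t: "t \<in> {0..1}"
  obtains \<Phi> I where
    "\<And>z1. ((\<lambda>z2. fejer K z2 * curve_avg g t M x (w1 + z1) (w2 + z2)) has_integral \<Phi> z1) {-(1/2)..1/2}"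
    "((\<lambda>z1. fejer K z1 * \<Phi> z1) has_integral I) {-(1/2)..1/2}"
    "\<bar>I\<bar> \<le> curve_exp_bound K g t M x"
proof -
  \<comment> \<open>What vertical smoothing leaves of the \<open>j\<close>-th summand, as a function
    of the horizontal position in one period; the cut at \<open>t\<close> remains.\<close>
  define h where "h j y = (if y < t then smooth_saw K (snd (x j) - w2 - g y) else 0)" for j y
  define \<Phi> where "\<Phi> z1 = (\<Sum>j<M. h j (frac (fst (x j) - w1 - z1))) / M" for z1
  have 1: "((\<lambda>z2. fejer K z2 * curve_avg g t M x (w1 + z1) (w2 + z2)) has_integral \<Phi> z1) {-(1/2)..1/2}" for z1
  proof -
    have "((\<lambda>z2. fejer K z2 * curve_saw g t a (b - z2)) has_integral
        (if frac a < t then smooth_saw K (b - g (frac a)) else 0)) {-(1/2)..1/2}" for a b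
      using has_integral_smooth_saw[of K "b - g (frac a)"] by (simp add: curve_saw_def algebra_simps)
    then have "((\<lambda>z2. (\<Sum>j<M. fejer K z2 * curve_saw g t (fst (x j) - w1 - z1) (snd (x j) - w2 - z2)) / M)
        has_integral \<Phi> z1) {-(1/2)..1/2}"
      unfolding \<Phi>_def h_def by (intro has_integral_divide has_integral_sum) auto
    then show ?thesis
      by (simp add: curve_avg_def sum_distrib_left diff_diff_eq)
  qed
  \<comment> \<open>The \<open>l\<close>-th Fourier coefficient of \<open>h j\<close>: inserting the
    polynomial for \<open>smooth_saw\<close> turns each term into a curve integral.\<close>
  define c where "c j l = (\<Sum>k\<in>freqs K. of_real (fejer_coeff K k) *
      (cis (2 * pi * (of_int k * (snd (x j) - w2))) * saw_coeff k) * curve_integral g t l k)" for j l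
  have hc: "((\<lambda>y. cis (- (2 * pi * (of_int l * y))) * of_real (h j y)) has_integral c j l) {0..1}" for j l
  proof -
    have "((\<lambda>y. \<Sum>k\<in>freqs K. of_real (fejer_coeff K k) *
        (cis (2 * pi * (of_int k * (snd (x j) - w2))) * saw_coeff k) *
        (if y < t then cis (- (2 * pi * (of_int l * y + of_int k * g y))) else 0)) has_integral c j l) {0..1}"
      unfolding c_def
      by (intro has_integral_sum has_integral_mult_right has_integral_curve_integral g t) auto
    moreover have "(\<Sum>k\<in>freqs K. of_real (fejer_coeff K k) *
        (cis (2 * pi * (of_int k * (snd (x j) - w2))) * saw_coeff k) *
        (if y < t then cis (- (2 * pi * (of_int l * y + of_int k * g y))) else 0)) =
        cis (- (2 * pi * (of_int l * y))) * of_real (h j y)" for y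
    proof (cases "y < t")
      case True
      have "cis (2 * pi * (of_int k * (snd (x j) - w2))) * cis (- (2 * pi * (of_int l * y + of_int k * g y))) =
          cis (- (2 * pi * (of_int l * y))) * cis (2 * pi * (of_int k * (snd (x j) - w2 - g y)))" for k
        by (simp add: cis_mult algebra_simps)
      then have *: "of_real (fejer_coeff K k) * (cis (2 * pi * (of_int k * (snd (x j) - w2))) * saw_coeff k)
          * cis (- (2 * pi * (of_int l * y + of_int k * g y))) =
        cis (- (2 * pi * (of_int l * y))) * (of_real (fejer_coeff K k) *
          (cis (2 * pi * (of_int k * (snd (x j) - w2 - g y))) * saw_coeff k))" for k
        by (rule mult_regroup)
      from True show ?thesis
        by (simp add: h_def smooth_saw_expand sum_distrib_left *)
    qed (simp add: h_def)
    ultimately show ?thesis by simp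
  qed
  define I where "I = (\<Sum>j<M. \<Sum>l\<in>freqs K. of_real (fejer_coeff K l) *
      (cis (2 * pi * (of_int l * (fst (x j) - w1))) * c j l)) / of_nat M"
  have "((\<lambda>z. (\<Sum>j<M. of_real (fejer K z) * complex_of_real (h j (frac (fst (x j) - w1 - z)))) / of_nat M)
      has_integral I) {-(1/2)..1/2}"
    unfolding I_def by (intro has_integral_divide has_integral_sum fejer_convolution hc) auto
  then have "((\<lambda>z. complex_of_real (fejer K z * \<Phi> z)) has_integral I) {-(1/2)..1/2}"
    by (simp add: \<Phi>_def sum_distrib_left)
  note I = has_integral_of_real_complex[OF this]
  \<comment> \<open>The points now occur only in exponentials, so moving the sum over
    \<open>j\<close> inside produces \<open>expsum\<close>, and the translation becomes a
    phase.\<close>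
  have "I = (\<Sum>l\<in>freqs K. \<Sum>k\<in>freqs K. of_real (fejer_coeff K l) * of_real (fejer_coeff K k) *
      saw_coeff k * curve_integral g t l k * cis (- (2 * pi * (of_int l * w1 + of_int k * w2))) *
      expsum M x (l, k))"
  proof -
    let ?term = "\<lambda>j l k. of_real (fejer_coeff K l) * of_real (fejer_coeff K k) *
      saw_coeff k * curve_integral g t l k * cis (- (2 * pi * (of_int l * w1 + of_int k * w2))) *
      (1 / of_nat M * cis (2 * pi * (of_int l * fst (x j) + of_int k * snd (x j))))"
    have "I = (\<Sum>j<M. \<Sum>l\<in>freqs K. \<Sum>k\<in>freqs K. ?term j l k)"
    proof -
      have "cis (2 * pi * (of_int l * (fst (x j) - w1))) * cis (2 * pi * (of_int k * (snd (x j) - w2))) =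
         cis (- (2 * pi * (of_int l * w1 + of_int k * w2))) *
         cis (2 * pi * (of_int l * fst (x j) + of_int k * snd (x j)))" for j l k
        by (simp add: cis_mult algebra_simps)
      then have *: "of_real (fejer_coeff K l) * (cis (2 * pi * (of_int l * (fst (x j) - w1))) *
          (of_real (fejer_coeff K k) * (cis (2 * pi * (of_int k * (snd (x j) - w2))) * saw_coeff k) *
           curve_integral g t l k)) / of_nat M = ?term j l k" for j l k
        by (rule mult_regroup_divide)
      show ?thesis
        unfolding I_def c_def sum_divide_distrib sum_distrib_left * ..
    qed
    also have "\<dots> = (\<Sum>l\<in>freqs K. \<Sum>j<M. \<Sum>k\<in>freqs K. ?term j l k)"
      by (rule sum.swap)
    also have "\<dots> = (\<Sum>l\<in>freqs K. \<Sum>k\<in>freqs K. \<Sum>j<M. ?term j l k)"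
      by (intro sum.cong refl sum.swap)
    finally show ?thesis
      by (simp only: expsum_def sum_distrib_left fst_conv snd_conv)
  qed
  also have "cmod \<dots> \<le> curve_exp_bound K g t M x"
    unfolding curve_exp_bound_def
  proof (intro sum_norm_le)
    fix l k
    let ?c = "cmod (saw_coeff k) * cmod (curve_integral g t l k) * cmod (expsum M x (l, k))"
    have "cmod (of_real (fejer_coeff K l) * of_real (fejer_coeff K k) *
      saw_coeff k * curve_integral g t l k * cis (- (2 * pi * (of_int l * w1 + of_int k * w2))) *
      expsum M x (l, k)) = fejer_coeff K l * fejer_coeff K k * ?c"
      using fejer_coeff_nonneg[of K k] fejer_coeff_nonneg[of K l] by (simp add: norm_mult)
    also have "\<dots> \<le> 1 * 1 * ?c"
      by (intro mult_right_mono mult_mono fejer_coeff_le_1 fejer_coeff_nonneg) auto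
    finally show "cmod (of_real (fejer_coeff K l) * of_real (fejer_coeff K k) *
      saw_coeff k * curve_integral g t l k * cis (- (2 * pi * (of_int l * w1 + of_int k * w2))) *
      expsum M x (l, k)) \<le> ?c" by simp
  qed
  finally have "\<bar>Re I\<bar> \<le> curve_exp_bound K g t M x"
    using abs_Re_le_cmod[of I] by linarith
  with 1 I(1) that show ?thesis by blast
qed

text \<open>The indicator of an arc minus its length is a difference of two sawtooths; this turns a
  count of points in a strip into sawtooth sums.\<close>

lemma frac_strip:
  assumes "0 < \<delta>" "\<delta> \<le> 1/2"
  shows "(if frac v < 2 * \<delta> then 1 else 0) = saw (v - 2 * \<delta>) - saw v + 2 * \<delta>"
proof -
  have "frac (v - 2 * \<delta>) = (if frac v < 2 * \<delta> then frac v - 2 * \<delta> + 1 else frac v - 2 * \<delta>)"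
  proof -
    have "frac (v - 2 * \<delta>) = frac v - 2 * \<delta> + 1" if "frac v < 2 * \<delta>"
      unfolding frac_unique_iff
    proof (intro conjI)
      show "v - 2 * \<delta> - (frac v - 2 * \<delta> + 1) \<in> \<int>" by (simp add: frac_def)
    qed (use that assms frac_ge_0[of v] in linarith)+
    moreover have "frac (v - 2 * \<delta>) = frac v - 2 * \<delta>" if "\<not> frac v < 2 * \<delta>"
      unfolding frac_unique_iff
    proof (intro conjI)
      show "v - 2 * \<delta> - (frac v - 2 * \<delta>) \<in> \<int>" by (simp add: frac_def)
    qed (use that assms frac_lt_1[of v] in linarith)+
    ultimately show ?thesis by simp
  qed
  then show ?thesis by (auto simp: saw_def)
qed

text \<open>The two conditions keep \<open>frac u\<close> at distance at least
  \<open>\<delta>\<close> from 0, 1 and \<open>t\<close>, so the shift neither wraps around nor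
  crosses the cut.\<close>

lemma off_strip:
  fixes \<delta> t u z :: real
  assumes \<delta>: "0 < \<delta>" "\<delta> \<le> 1/2" and t: "t \<in> {0..1}" and z: "\<bar>z\<bar> \<le> \<delta>"
    and off: "frac (u + \<delta>) \<ge> 2 * \<delta>" "frac (u - t + \<delta>) \<ge> 2 * \<delta>"
  shows "frac (u - z) = frac u - z" "frac u - z < t \<longleftrightarrow> frac u < t"
proof -
  let ?f = "frac u"
  have f: "0 \<le> ?f" "?f < 1" by (auto simp: frac_lt_1)
  have u: "u = ?f + of_int \<lfloor>u\<rfloor>" by (simp add: frac_def)
  have shift: "frac (u + d) = frac (?f + d)" for d
    by (subst u) (metis add.assoc add.commute frac_add_of_int_right)
  have f': "\<delta> \<le> ?f" "?f < 1 - \<delta>"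
  proof -
    have "?f + \<delta> < 1"
    proof (rule ccontr)
      assume "\<not> ?f + \<delta> < 1"
      then have "frac (?f + \<delta>) = ?f + \<delta> - 1"
        unfolding frac_unique_iff using f \<delta> by auto
      then show False using off(1) f \<delta> unfolding shift by linarith
    qed
    moreover from this have "frac (?f + \<delta>) = ?f + \<delta>"
      using f \<delta> by (intro frac_eq_id) auto
    ultimately show "\<delta> \<le> ?f" "?f < 1 - \<delta>"
      using off(1) unfolding shift by linarith+
  qed
  have "frac (?f - z) = ?f - z"
    using f' z by (intro frac_eq_id) auto
  then show "frac (u - z) = ?f - z"
    using shift[of "- z"] by simp
  show "frac u - z < t \<longleftrightarrow> frac u < t"
  proof (cases "?f - t + \<delta> < 0")
    case True
    then show ?thesis using z by linarith
  next
    case False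
    then have "frac (?f - t + \<delta>) = ?f - t + \<delta>"
      using f' t by (intro frac_eq_id) auto
    then have "?f \<ge> t + \<delta>"
      using off(2) shift[of "- t + \<delta>"] by (simp add: algebra_simps)
    then show ?thesis using z \<delta> by linarith
  qed
qed

text \<open>Translating by at most \<open>\<delta>\<close> can carry a point across one of the vertical edges \<open>0\<close> and \<open>t\<close> only
  if the point lies in one of these two strips, whose point counts are controlled by sawtooth sums.\<close>
definition near_ends :: "real \<Rightarrow> real \<Rightarrow> real \<Rightarrow> real" where
  "near_ends \<delta> t u = (if frac (u + \<delta>) < 2 * \<delta> then 1 else 0) + (if frac (u - t + \<delta>) < 2 * \<delta> then 1 else 0)"

text \<open>Away from the edges, \<open>z2\<close> and the variation of \<open>g\<close> change the
  argument of \<open>saw\<close> by at most \<open>(Lam + 1) * \<delta>\<close>; the deliberate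
  vertical shift of exactly this size makes the total change \<open>H\<close> one-signed. Near an
  edge, the trivial change of at most 1 is paid for by \<open>near_ends\<close>.\<close>

lemma curve_saw_shift:
  assumes \<delta>: "0 < \<delta>" "\<delta> \<le> 1/2" and t: "t \<in> {0..1}"
    and lip: "\<And>y z. y \<in> {0..1} \<Longrightarrow> z \<in> {0..1} \<Longrightarrow> \<bar>g y - g z\<bar> \<le> Lam * \<bar>y - z\<bar>"
    and Lam: "Lam \<ge> 0"
    and z: "\<bar>z1\<bar> \<le> \<delta>" "\<bar>z2\<bar> \<le> \<delta>" and s: "\<bar>s\<bar> = 1"
  shows "s * curve_saw g t (u - z1) (b - s * ((Lam + 1) * \<delta>) - z2)
    \<ge> s * curve_saw g t u b - 2 * ((Lam + 1) * \<delta>) - near_ends \<delta> t u"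
proof (cases "frac (u + \<delta>) \<ge> 2 * \<delta> \<and> frac (u - t + \<delta>) \<ge> 2 * \<delta>")
  case True
  then have ne: "near_ends \<delta> t u = 0" by (simp add: near_ends_def)
  have off: "frac (u - z1) = frac u - z1" "frac u - z1 < t \<longleftrightarrow> frac u < t"
    using off_strip[OF \<delta> t z(1)] True by auto
  have f: "frac u \<in> {0..1}" "frac u - z1 \<in> {0..1}"
    using frac_ge_0[of "u - z1"] frac_lt_1[of "u - z1"] frac_lt_1[of u] off by auto
  define d where "d = g (frac u - z1) - g (frac u)"
  have d: "\<bar>d\<bar> \<le> Lam * \<delta>"
    unfolding d_def using lip[OF f(2,1)] mult_left_mono[OF z(1) Lam] by simp
  define H where "H = s * ((Lam + 1) * \<delta>) + z2 + d"
  have h: "0 \<le> s * H" "s * H \<le> 2 * ((Lam + 1) * \<delta>)"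
  proof -
    have "s = 1 \<or> s = -1" using s by auto
    then show "0 \<le> s * H" "s * H \<le> 2 * ((Lam + 1) * \<delta>)"
      using d z(2) by (auto simp: H_def algebra_simps)
  qed
  show ?thesis
  proof (cases "frac u < t")
    case False
    then show ?thesis using off ne \<delta> Lam by (simp add: curve_saw_def)
  next
    case True
    let ?v = "b - g (frac u)"
    have eq: "curve_saw g t (u - z1) (b - s * ((Lam + 1) * \<delta>) - z2) = saw (?v - H)"
      "curve_saw g t u b = saw ?v"
    proof -
      have "b - s * ((Lam + 1) * \<delta>) - z2 - g (frac u - z1) = ?v - H"
        by (simp add: d_def H_def)
      moreover have "curve_saw g t (u - z1) (b - s * ((Lam + 1) * \<delta>) - z2)
          = saw (b - s * ((Lam + 1) * \<delta>) - z2 - g (frac u - z1))"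
        using True off by (simp add: curve_saw_def)
      ultimately show "curve_saw g t (u - z1) (b - s * ((Lam + 1) * \<delta>) - z2) = saw (?v - H)"
        by (simp only:)
      show "curve_saw g t u b = saw ?v"
        using True by (simp add: curve_saw_def)
    qed
    show ?thesis
    proof (cases "s = 1")
      case True
      then show ?thesis using saw_diff_ge[of H ?v] h ne unfolding eq by simp
    next
      case False
      then have "s = -1" using s by auto
      then show ?thesis using saw_add_le[of "- H" ?v] h ne unfolding eq by simp
    qed
  qed
next
  case False
  then have ne: "near_ends \<delta> t u \<ge> 1" by (auto simp: near_ends_def)
  have b: "\<bar>s * curve_saw g t a c\<bar> \<le> 1/2" for a c
    using s curve_saw_bound by (simp add: abs_mult)
  have "(Lam + 1) * \<delta> \<ge> 0" using Lam \<delta> by simp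
  then show ?thesis
    using b[of u b] b[of "u - z1" "b - s * ((Lam + 1) * \<delta>) - z2"] ne by linarith
qed

text \<open>Two-dimensional counterpart of \<open>saw_sum_bound\<close>; \<open>D1\<close> is the
  price of the points that cross a vertical edge.\<close>

lemma curve_avg_bound:
  fixes x :: "nat \<Rightarrow> real \<times> real"
  assumes K: "K \<ge> 8" and M: "M \<ge> 1" and t: "t \<in> {0..1}"
    and lip: "\<And>y z. y \<in> {0..1} \<Longrightarrow> z \<in> {0..1} \<Longrightarrow> \<bar>g y - g z\<bar> \<le> Lam * \<bar>y - z\<bar>"
    and Lam: "Lam \<ge> 0"
    and D1: "\<And>w. \<bar>(\<Sum>j<M. saw (fst (x j) - w)) / M\<bar> \<le> D1"
  shows "\<bar>curve_avg g t M x w1 w2\<bar> \<le> 2 * curve_exp_bound K g t M x + 2 * ((8 * Lam + 24) / K + 4 * D1)"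
proof -
  define \<delta> where "\<delta> = 4 / real K"
  have \<delta>: "0 < \<delta>" "\<delta> \<le> 1/2" using K by (auto simp: \<delta>_def field_simps)
  \<comment> \<open>The loss of the one-signed displacement, the total length of two arcs of length
    \<open>2 * \<delta>\<close>, and the four sawtooth averages that describe these arcs.\<close>
  define \<eta> where "\<eta> = 2 * ((Lam + 1) * \<delta>) + 4 * \<delta> + 4 * D1"
  have D1_nonneg: "D1 \<ge> 0" using D1[of 0] by linarith
  have g: "continuous_on {0..1} g"
  proof (rule lipschitz_on_continuous_on)
    show "Lam-lipschitz_on {0..1} g"
      by (rule lipschitz_onI) (use lip Lam in \<open>auto simp: dist_real_def\<close>)
  qed
  let ?E = "\<lambda>p. curve_avg g t M x (fst p) (snd p)"
  have "\<bar>?E (w1, w2)\<bar> \<le> 2 * curve_exp_bound K g t M x + 2 * \<eta>"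
  proof (rule abs_le_if_averages_le[where E = ?E])
    show "\<bar>?E p\<bar> \<le> 1" for p
    proof -
      have "\<bar>\<Sum>j<M. curve_saw g t (fst (x j) - fst p) (snd (x j) - snd p)\<bar> \<le>
        (\<Sum>j<M. \<bar>curve_saw g t (fst (x j) - fst p) (snd (x j) - snd p)\<bar>)"
        by (rule sum_abs)
      also have "\<dots> \<le> (\<Sum>j<M. 1)"
        by (intro sum_mono order_trans[OF curve_saw_bound]) auto
      finally show ?thesis using M by (simp add: curve_avg_def)
    qed
    show "0 \<le> curve_exp_bound K g t M x"
      unfolding curve_exp_bound_def by (intro sum_nonneg) auto
    show "0 \<le> \<eta>" using \<delta> Lam D1_nonneg by (simp add: \<eta>_def)
    fix p :: "real \<times> real" and s D A :: real
    assume s: "\<bar>s\<bar> = 1" and D: "\<And>q. \<bar>?E q\<bar> \<le> D" and A: "A \<le> s * ?E p - \<eta>" "- D \<le> A"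
    define v2 where "v2 = snd p + s * ((Lam + 1) * \<delta>)"
    obtain \<Phi> I where \<Phi>:
      "\<And>z1. ((\<lambda>z2. fejer K z2 * curve_avg g t M x (fst p + z1) (v2 + z2)) has_integral \<Phi> z1) {-(1/2)..1/2}"
      and I: "((\<lambda>z1. fejer K z1 * \<Phi> z1) has_integral I) {-(1/2)..1/2}"
      and IB: "\<bar>I\<bar> \<le> curve_exp_bound K g t M x"
      by (rule curve_avg_smooth[OF g t, where K = K and M = M and x = x and ?w1.0 = "fst p" and ?w2.0 = v2]) (rule that)
    have strip: "(\<Sum>j<M. near_ends \<delta> t (fst (x j) - fst p)) / M \<le> 4 * \<delta> + 4 * D1"
    proof -
      let ?S = "\<lambda>w. (\<Sum>j<M. saw (fst (x j) - w)) / M"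
      have "near_ends \<delta> t (fst (x j) - fst p) =
          saw (fst (x j) - (fst p + \<delta>)) - saw (fst (x j) - (fst p - \<delta>))
          + saw (fst (x j) - (fst p + t + \<delta>)) - saw (fst (x j) - (fst p + t - \<delta>)) + 4 * \<delta>" for j
        unfolding near_ends_def frac_strip[OF \<delta>] by (simp add: algebra_simps)
      then have "(\<Sum>j<M. near_ends \<delta> t (fst (x j) - fst p)) / M =
          ?S (fst p + \<delta>) - ?S (fst p - \<delta>) + ?S (fst p + t + \<delta>) - ?S (fst p + t - \<delta>) + 4 * \<delta>"
        using M by (simp add: sum.distrib sum_subtractf add_divide_distrib diff_divide_distrib)
      then show ?thesis
        using D1[of "fst p + \<delta>"] D1[of "fst p - \<delta>"] D1[of "fst p + t + \<delta>"] D1[of "fst p + t - \<delta>"]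
        by linarith
    qed
    have near: "s * curve_avg g t M x (fst p + z1) (v2 + z2) \<ge> A" if z: "\<bar>z1\<bar> \<le> \<delta>" "\<bar>z2\<bar> \<le> \<delta>" for z1 z2
    proof -
      have "(\<Sum>j<M. s * curve_saw g t (fst (x j) - fst p) (snd (x j) - snd p)
            - 2 * ((Lam + 1) * \<delta>) - near_ends \<delta> t (fst (x j) - fst p)) \<le>
          (\<Sum>j<M. s * curve_saw g t (fst (x j) - (fst p + z1)) (snd (x j) - (v2 + z2)))"
      proof (rule sum_mono)
        fix j
        show "s * curve_saw g t (fst (x j) - fst p) (snd (x j) - snd p)
            - 2 * ((Lam + 1) * \<delta>) - near_ends \<delta> t (fst (x j) - fst p) \<le>
          s * curve_saw g t (fst (x j) - (fst p + z1)) (snd (x j) - (v2 + z2))"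
          using curve_saw_shift[OF \<delta> t lip Lam z s, of "fst (x j) - fst p" "snd (x j) - snd p"]
          by (simp add: v2_def diff_diff_eq add.assoc)
      qed
      then have "(\<Sum>j<M. s * curve_saw g t (fst (x j) - fst p) (snd (x j) - snd p)
            - 2 * ((Lam + 1) * \<delta>) - near_ends \<delta> t (fst (x j) - fst p)) / M \<le>
          (\<Sum>j<M. s * curve_saw g t (fst (x j) - (fst p + z1)) (snd (x j) - (v2 + z2))) / M"
        by (rule divide_right_mono) simp
      then have "s * ?E p - 2 * ((Lam + 1) * \<delta>) - (\<Sum>j<M. near_ends \<delta> t (fst (x j) - fst p)) / M
          \<le> s * curve_avg g t M x (fst p + z1) (v2 + z2)"
        using M by (simp add: curve_avg_def sum_subtractf diff_divide_distrib flip: sum_distrib_left)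
      then show ?thesis using A(1) strip unfolding \<eta>_def by linarith
    qed
    have far: "s * curve_avg g t M x z1 z2 \<ge> - D" for z1 z2
      using D[of "(z1, z2)"] s by (auto simp: abs_if split: if_splits)
    have s\<Phi>: "((\<lambda>z2. fejer K z2 * (s * curve_avg g t M x (fst p + z1) (v2 + z2))) has_integral s * \<Phi> z1) {-(1/2)..1/2}" for z1
      using has_integral_mult_right[OF \<Phi>, of s z1] by (simp add: mult_ac)
    have sI: "((\<lambda>z1. fejer K z1 * (s * \<Phi> z1)) has_integral s * I) {-(1/2)..1/2}"
      using has_integral_mult_right[OF I, of s] by (simp add: mult_ac)
    \<comment> \<open>The inner convolution, in \<open>z2\<close>, gives
      \<open>- D + (A + D) * (7/8)\<close> for \<open>z1\<close> in the window and
      \<open>- D\<close> elsewhere; the outer one turns the factor into 49/64, still above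
      3/4.\<close>
    have "- D + ((- D + (A + D) * (7/8)) + D) * (7/8) \<le> s * I"
    proof (rule fejer_average_ge[OF K sI])
      show "- D \<le> s * \<Phi> z" for z
        using fejer_average_ge[OF K s\<Phi>[of z], where D = D and A = "- D"] far by simp
      show "- D + (A + D) * (7/8) \<le> s * \<Phi> z" if "\<bar>z\<bar> \<le> 4 / K" for z
        using fejer_average_ge[OF K s\<Phi>[of z], where D = D and A = A] far near A(2) that
        by (simp add: \<delta>_def)
      have "0 \<le> (A + D) * (7/8)" using A(2) by (intro mult_nonneg_nonneg) auto
      then show "- D \<le> - D + (A + D) * (7/8)" by linarith
    qed
    moreover have "s * I \<le> \<bar>I\<bar>" using s by (auto simp: abs_if split: if_splits)
    ultimately show "- D + (A + D) * (3/4) \<le> curve_exp_bound K g t M x"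
      using A(2) IB by (simp add: algebra_simps)
  qed
  also have "\<eta> = (8 * Lam + 24) / K + 4 * D1"
    by (simp add: \<eta>_def \<delta>_def add_divide_distrib algebra_simps)
  finally show ?thesis by simp
qed

subsection \<open>Discrepancy\<close>

lemma Qcrit_freq_weight:
  "Qcrit R M x = 1 / R + (\<Sum>n \<in> {n :: int \<times> int. 0 < maxnorm n \<and> real_of_int (maxnorm n) < R}.
     freq_weight (fst n) (snd n) * cmod (expsum M x n))"
  by (simp add: Qcrit_def freq_weight_def)

lemma freq_weight_nonneg: "freq_weight l k \<ge> 0"
  by (simp add: freq_weight_def)

lemma finite_maxnorm_less: "finite {n :: int \<times> int. 0 < maxnorm n \<and> real_of_int (maxnorm n) < R}"
proof (rule finite_subset)
  show "{n :: int \<times> int. 0 < maxnorm n \<and> real_of_int (maxnorm n) < R} \<subseteq> {-\<lceil>R\<rceil>..\<lceil>R\<rceil>} \<times> {-\<lceil>R\<rceil>..\<lceil>R\<rceil>}"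
  proof
    fix n :: "int \<times> int"
    assume "n \<in> {n. 0 < maxnorm n \<and> real_of_int (maxnorm n) < R}"
    then have "maxnorm n \<le> \<lceil>R\<rceil>" by (simp add: le_ceiling_iff)
    then show "n \<in> {-\<lceil>R\<rceil>..\<lceil>R\<rceil>} \<times> {-\<lceil>R\<rceil>..\<lceil>R\<rceil>}"
      by (auto simp: maxnorm_def mem_Times_iff)
  qed
qed auto

lemma sum_freqs_le_Qcrit:
  assumes R: "R > 0" and S: "S \<subseteq> {n. 0 < maxnorm n \<and> real_of_int (maxnorm n) < R}"
  shows "(\<Sum>n\<in>S. freq_weight (fst n) (snd n) * cmod (expsum M x n)) \<le> Qcrit R M x"
proof -
  have "(\<Sum>n\<in>S. freq_weight (fst n) (snd n) * cmod (expsum M x n)) \<le>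
    (\<Sum>n \<in> {n. 0 < maxnorm n \<and> real_of_int (maxnorm n) < R}. freq_weight (fst n) (snd n) * cmod (expsum M x n))"
    by (intro sum_mono2 finite_maxnorm_less S mult_nonneg_nonneg freq_weight_nonneg) auto
  moreover have "1 / R \<ge> 0" using R by simp
  ultimately show ?thesis unfolding Qcrit_freq_weight by linarith
qed

lemma maxnorm_freqs:
  assumes "l \<in> freqs K" "k \<in> freqs K" "real K - 1 < R"
  shows "real_of_int (maxnorm (l, k)) < R"
proof -
  have "maxnorm (l, k) \<le> int K - 1"
    using assms by (auto simp: maxnorm_def)
  then show ?thesis using assms(3) by linarith
qed

lemma curve_exp_bound_le:
  assumes R: "R > 0" "real K - 1 < R" and C: "C \<ge> 0"
    "\<And>l k. k \<noteq> 0 \<Longrightarrow> cmod (saw_coeff k) * cmod (curve_integral g t l k) \<le> C * freq_weight l k"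
  shows "curve_exp_bound K g t M x \<le> C * Qcrit R M x"
proof -
  let ?f = "\<lambda>n. cmod (saw_coeff (snd n)) * cmod (curve_integral g t (fst n) (snd n)) * cmod (expsum M x n)"
  let ?S = "freqs K \<times> (freqs K - {0})"
  have "curve_exp_bound K g t M x = (\<Sum>n\<in>freqs K \<times> freqs K. ?f n)"
    by (simp add: curve_exp_bound_def sum.cartesian_product case_prod_beta)
  \<comment> \<open>\<open>saw_coeff 0 = 0\<close> deletes the terms with \<open>k = 0\<close>,
    among them the zero frequency, which \<open>Qcrit\<close> does not contain.\<close>
  also have "\<dots> = (\<Sum>n\<in>?S. ?f n)"
    by (rule sum.mono_neutral_right) (auto simp: saw_coeff_def)
  also have "\<dots> \<le> (\<Sum>n\<in>?S. C * freq_weight (fst n) (snd n) * cmod (expsum M x n))"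
    by (intro sum_mono mult_right_mono C) auto
  also have "\<dots> = C * (\<Sum>n\<in>?S. freq_weight (fst n) (snd n) * cmod (expsum M x n))"
    by (simp add: sum_distrib_left mult_ac)
  also have "\<dots> \<le> C * Qcrit R M x"
  proof (intro mult_left_mono sum_freqs_le_Qcrit R C)
    show "?S \<subseteq> {n. 0 < maxnorm n \<and> real_of_int (maxnorm n) < R}"
    proof safe
      fix l k assume lk: "l \<in> freqs K" "k \<in> freqs K" "k \<noteq> 0"
      show "0 < maxnorm (l, k)" using lk by (auto simp: maxnorm_def)
      show "real_of_int (maxnorm (l, k)) < R" using maxnorm_freqs[OF lk(1,2) R(2)] .
    qed
  qed
  finally show ?thesis .
qed

text \<open>Exponential sums of the first coordinates are \<open>expsum\<close> at
  \<open>(k, 0)\<close>, where the product part of the weight is 1/(1 + |k|) and dominates the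
  sawtooth coefficient.\<close>

lemma saw_exp_bound_le:
  assumes R: "R > 0" "real K - 1 < R"
  shows "(\<Sum>k\<in>freqs K. cmod (saw_coeff k) *
      cmod ((1 / of_nat M) * (\<Sum>j<M. cis (2 * pi * (of_int k * fst (x j)))))) \<le> Qcrit R M x"
proof -
  let ?S = "(\<lambda>k. (k, 0)) ` (freqs K - {0})"
  have "(\<Sum>k\<in>freqs K. cmod (saw_coeff k) *
      cmod ((1 / of_nat M) * (\<Sum>j<M. cis (2 * pi * (of_int k * fst (x j)))))) =
     (\<Sum>k\<in>freqs K - {0}. cmod (saw_coeff k) * cmod (expsum M x (k, 0)))"
    by (intro sum.mono_neutral_cong_right) (auto simp: saw_coeff_def expsum_def)
  also have "\<dots> \<le> (\<Sum>k\<in>freqs K - {0}. freq_weight k 0 * cmod (expsum M x (k, 0)))"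
  proof (intro sum_mono mult_right_mono)
    fix k assume "k \<in> freqs K - {0}"
    then show "cmod (saw_coeff k) \<le> freq_weight k 0"
      using norm_saw_coeff_le[of k] by (simp add: freq_weight_def add_increasing)
  qed auto
  also have "\<dots> = (\<Sum>n\<in>?S. freq_weight (fst n) (snd n) * cmod (expsum M x n))"
    by (subst sum.reindex) (auto simp: inj_on_def)
  also have "\<dots> \<le> Qcrit R M x"
  proof (intro sum_freqs_le_Qcrit R)
    show "?S \<subseteq> {n. 0 < maxnorm n \<and> real_of_int (maxnorm n) < R}"
    proof safe
      fix k assume k: "k \<in> freqs K" "k \<noteq> 0"
      show "0 < maxnorm (k, 0)" using k by (auto simp: maxnorm_def)
      have "0 \<in> freqs K" using k by auto
      then show "real_of_int (maxnorm (k, 0)) < R" using maxnorm_freqs[OF k(1) _ R(2)] by blast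
    qed
  qed
  finally show ?thesis .
qed

text \<open>The floor of \<open>b - y\<close> counts whether \<open>b\<close> lies below \<open>y\<close>. In the upper bound the positive
  \<open>e\<close> accounts for points on the graph.\<close>
lemma indicator_saw_bounds:
  assumes b: "0 \<le> b" "b < 1" and y: "0 \<le> y" "y \<le> 1" and e: "e > 0"
  shows "y + saw (b - y) - saw b \<le> (if b \<le> y then 1 else 0)"
    and "(if b \<le> y then 1 else 0) \<le> y + e + saw (b - e - y) - saw b"
proof -
  have sb: "saw b = b - 1/2" using b by (simp add: saw_def)
  have "\<lfloor>b - y\<rfloor> \<ge> -1" "\<not> b \<le> y \<Longrightarrow> \<lfloor>b - y\<rfloor> \<ge> 0"
    using b y by (auto simp: le_floor_iff)
  then show "y + saw (b - y) - saw b \<le> (if b \<le> y then 1 else 0)"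
    unfolding sb by (auto simp: saw_def frac_def)
  have "\<lfloor>b - e - y\<rfloor> \<le> 0" "b \<le> y \<Longrightarrow> \<lfloor>b - e - y\<rfloor> \<le> -1"
    using b y e by (auto simp: floor_le_iff)
  then show "(if b \<le> y then 1 else 0) \<le> y + e + saw (b - e - y) - saw b"
    unfolding sb by (auto simp: saw_def frac_def)
qed

section \<open>Counting points below the graph\<close>

definition count_below :: "(real \<Rightarrow> real) \<Rightarrow> nat \<Rightarrow> (nat \<Rightarrow> real \<times> real) \<Rightarrow> real \<Rightarrow> real" where
  "count_below g M x t = (\<Sum>j<M. if fst (x j) < t \<and> snd (x j) \<le> g (fst (x j)) then 1 else 0)"

text \<open>\<open>B1\<close> and \<open>B2\<close> hold for all translations. This uniformity lets
  a vertical translation by \<open>e\<close> take care of the points on the graph, with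
  \<open>e\<close> tending to 0 afterwards.\<close>

lemma count_below_bound:
  assumes M: "M \<ge> 1" and x: "\<And>j. j < M \<Longrightarrow> x j \<in> {0..<1} \<times> {0..<1}"
    and g: "\<And>y. y \<in> {0..1} \<Longrightarrow> g y \<in> {0..1}"
    and B1: "\<And>w1 w2. \<bar>curve_avg g t M x w1 w2\<bar> \<le> B1"
    and B2: "\<And>w1 w2. \<bar>curve_avg (\<lambda>_. 0) t M x w1 w2\<bar> \<le> B2"
  shows "\<bar>count_below g M x t / M - (\<Sum>j<M. if fst (x j) < t then g (fst (x j)) else 0) / M\<bar> \<le> B1 + B2"
proof -
  let ?a = "\<lambda>j. fst (x j)" and ?b = "\<lambda>j. snd (x j)"
  let ?A = "(\<Sum>j<M. if ?a j < t then g (?a j) else 0) / M"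
  have xj: "frac (?a j) = ?a j" "0 \<le> ?b j" "?b j < 1" "0 \<le> g (?a j)" "g (?a j) \<le> 1" if "j < M" for j
    using x[OF that] g[of "?a j"] by (auto simp: mem_Times_iff)
  have "count_below g M x t \<ge>
      (\<Sum>j<M. (if ?a j < t then g (?a j) else 0) + curve_saw g t (?a j - 0) (?b j - 0)
        - curve_saw (\<lambda>_. 0) t (?a j - 0) (?b j - 0))"
    unfolding count_below_def
  proof (rule sum_mono)
    fix j assume "j \<in> {..<M}"
    then have j: "j < M" by simp
    show "(if ?a j < t then g (?a j) else 0) + curve_saw g t (?a j - 0) (?b j - 0)
        - curve_saw (\<lambda>_. 0) t (?a j - 0) (?b j - 0) \<le> (if ?a j < t \<and> ?b j \<le> g (?a j) then 1 else 0)"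
      using indicator_saw_bounds(1)[OF xj(2-5)[OF j] zero_less_one] xj(1)[OF j]
      by (cases "?a j < t"; cases "?b j \<le> g (?a j)") (simp_all add: curve_saw_def)
  qed
  then have "count_below g M x t / M \<ge>
      (\<Sum>j<M. (if ?a j < t then g (?a j) else 0) + curve_saw g t (?a j - 0) (?b j - 0)
        - curve_saw (\<lambda>_. 0) t (?a j - 0) (?b j - 0)) / M"
    by (rule divide_right_mono) simp
  also have "(\<Sum>j<M. (if ?a j < t then g (?a j) else 0) + curve_saw g t (?a j - 0) (?b j - 0)
        - curve_saw (\<lambda>_. 0) t (?a j - 0) (?b j - 0)) / M =
      ?A + curve_avg g t M x 0 0 - curve_avg (\<lambda>_. 0) t M x 0 0"
    by (simp only: curve_avg_def sum.distrib sum_subtractf add_divide_distrib diff_divide_distrib)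
  finally have lower: "count_below g M x t / M \<ge> ?A - (B1 + B2)"
    using B1[of 0 0] B2[of 0 0] by linarith
  have "count_below g M x t / M \<le> ?A + (B1 + B2) + e" if e: "e > 0" for e
  proof -
    have "count_below g M x t \<le>
        (\<Sum>j<M. (if ?a j < t then g (?a j) else 0) + e + curve_saw g t (?a j - 0) (?b j - e)
          - curve_saw (\<lambda>_. 0) t (?a j - 0) (?b j - 0))"
      unfolding count_below_def
    proof (rule sum_mono)
      fix j assume "j \<in> {..<M}"
      then have j: "j < M" by simp
      show "(if ?a j < t \<and> ?b j \<le> g (?a j) then 1 else 0) \<le>
          (if ?a j < t then g (?a j) else 0) + e + curve_saw g t (?a j - 0) (?b j - e)
          - curve_saw (\<lambda>_. 0) t (?a j - 0) (?b j - 0)"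
        using indicator_saw_bounds(2)[OF xj(2-5)[OF j] e] xj(1)[OF j] e
        by (cases "?a j < t"; cases "?b j \<le> g (?a j)") (simp_all add: curve_saw_def)
    qed
    then have "count_below g M x t / M \<le>
        (\<Sum>j<M. (if ?a j < t then g (?a j) else 0) + e + curve_saw g t (?a j - 0) (?b j - e)
          - curve_saw (\<lambda>_. 0) t (?a j - 0) (?b j - 0)) / M"
      by (rule divide_right_mono) simp
    also have "\<dots> = ?A + (\<Sum>j<M. e) / M + curve_avg g t M x 0 e - curve_avg (\<lambda>_. 0) t M x 0 0"
      by (simp only: curve_avg_def sum.distrib sum_subtractf add_divide_distrib diff_divide_distrib)
    also have "(\<Sum>j<M. e) / M = e" using M by simp
    finally show ?thesis using B1[of 0 e] B2[of 0 0] by linarith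
  qed
  then have "count_below g M x t / M \<le> ?A + (B1 + B2)"
    by (rule field_le_epsilon)
  with lower show ?thesis by linarith
qed

text \<open>Koksma's inequality for \<open>g\<close> cut off at \<open>t\<close>: the jump at
  \<open>t\<close> contributes at most 1 to the variation, the interior at most \<open>Lam\<close>,
  and \<open>2 * D1\<close> bounds the discrepancy of the points.\<close>

lemma Koksma_C1:
  fixes a :: "nat \<Rightarrow> real" and g g' :: "real \<Rightarrow> real"
  assumes M: "M \<ge> 1" and t: "t \<in> {0..1}" and a: "\<And>j. j < M \<Longrightarrow> a j \<in> {0..<1}"
    and D1: "\<And>w. \<bar>(\<Sum>j<M. saw (a j - w)) / M\<bar> \<le> D1"
    and d: "\<And>z. z \<in> {0..1} \<Longrightarrow> (g has_real_derivative g' z) (at z within {0..1})"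
    and Lam: "\<And>z. z \<in> {0..1} \<Longrightarrow> \<bar>g' z\<bar> \<le> Lam"
    and g: "\<And>z. z \<in> {0..1} \<Longrightarrow> \<bar>g z\<bar> \<le> 1"
  shows "\<bar>(\<Sum>j<M. if a j < t then g (a j) else 0) / M - integral {0..t} g\<bar> \<le> (1 + Lam) * (2 * D1)"
proof -
  have D1_nonneg: "D1 \<ge> 0" using D1[of 0] by linarith
  \<comment> \<open>The local discrepancy on \<open>{0..<r}\<close>. The indicator of
    \<open>a j < r\<close> is \<open>r\<close> plus a difference of two sawtooths, whence
    \<open>2 * D1\<close>.\<close>
  define e where "e r = (\<Sum>j<M. if a j < r then 1 else 0) / M - r" for r :: real
  have e: "\<bar>e r\<bar> \<le> 2 * D1" if r: "r \<in> {0..1}" for r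
  proof -
    have "(if a j < r then 1 else 0) = saw (a j - r) - saw (a j - 0) + r" if "j < M" for j
    proof -
      have fa: "frac (a j) = a j" using a[OF that] by simp
      have "frac (a j - r) = (if a j < r then a j - r + 1 else a j - r)"
      proof (cases "a j < r")
        case True
        then show ?thesis
          unfolding frac_unique_iff using a[OF that] r by auto
      qed (use a[OF that] r in \<open>auto intro!: frac_eq_id\<close>)
      then show ?thesis using fa by (simp add: saw_def)
    qed
    then have "e r = (\<Sum>j<M. saw (a j - r) - saw (a j - 0) + r) / M - r"
      by (simp add: e_def)
    also have "\<dots> = (\<Sum>j<M. saw (a j - r)) / M - (\<Sum>j<M. saw (a j - 0)) / M"
      using M by (simp add: sum.distrib sum_subtractf add_divide_distrib diff_divide_distrib)
    finally show ?thesis using D1[of r] D1[of 0] by linarith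
  qed
  have sub: "{0..t} \<subseteq> {0..1}" using t by auto
  have g_int: "(g has_integral integral {0..t} g) {0..t}"
    by (intro integrable_integral integrable_continuous_real continuous_on_subset[OF _ sub]
        DERIV_continuous_on[OF d])
  let ?A = "(\<Sum>j<M. if a j < t then g (a j) else 0) / M"
  have 1: "((\<lambda>r. g' r * (if a j < r then 1 else 0)) has_integral
      (if a j < t then g t - g (a j) else 0)) {0..t}" if "j < M" for j
  proof (cases "a j < t")
    case True
    have sub': "{a j..t} \<subseteq> {0..t}" "{a j..t} \<subseteq> {0..1}" using a[OF that] t by auto
    have "(g' has_integral (g t - g (a j))) {a j..t}"
      using True sub' DERIV_subset[OF d sub'(2)]
      by (intro fundamental_theorem_of_calculus)
         (auto simp flip: has_real_derivative_iff_has_vector_derivative)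
    then have *: "((\<lambda>r. if r \<in> {a j..t} then g' r else 0) has_integral (g t - g (a j))) {0..t}"
      by (simp only: has_integral_restrict[OF sub'(1)])
    have "((\<lambda>r. g' r * (if a j < r then 1 else 0)) has_integral (g t - g (a j))) {0..t}"
      by (rule has_integral_spike[OF _ _ *, of "{a j}"]) (use True in auto)
    then show ?thesis using True by simp
  next
    case False
    have "((\<lambda>r. g' r * (if a j < r then 1 else 0)) has_integral 0) {0..t}"
      by (rule has_integral_is_0) (use False in auto)
    then show ?thesis using False by simp
  qed
  have 2: "((\<lambda>r. g' r * r) has_integral (g t * t - integral {0..t} g)) {0..t}"
  proof -
    have "((\<lambda>r. g' r * r + g r) has_integral (g t * t - g 0 * 0)) {0..t}"
    proof (rule fundamental_theorem_of_calculus)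
      fix r assume "r \<in> {0..t}"
      then have "(g has_real_derivative g' r) (at r within {0..t})"
        using DERIV_subset[OF d sub] sub by auto
      then show "((\<lambda>r. g r * r) has_vector_derivative g' r * r + g r) (at r within {0..t})"
        unfolding has_real_derivative_iff_has_vector_derivative [symmetric]
        by (auto intro!: derivative_eq_intros)
    qed (use t in auto)
    from has_integral_diff[OF this g_int] show ?thesis by simp
  qed
  have "((\<lambda>r. (\<Sum>j<M. g' r * (if a j < r then 1 else 0)) / M - g' r * r) has_integral
      ((\<Sum>j<M. if a j < t then g t - g (a j) else 0) / M - (g t * t - integral {0..t} g))) {0..t}"
    by (intro has_integral_diff has_integral_divide has_integral_sum 1 2) auto
  moreover have "(\<Sum>j<M. g' r * (if a j < r then 1 else 0)) / M - g' r * r = g' r * e r" for r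
    by (simp add: e_def right_diff_distrib flip: sum_distrib_left)
  moreover have "(\<Sum>j<M. if a j < t then g t - g (a j) else 0) = (\<Sum>j<M. g t * (if a j < t then 1 else 0) - (if a j < t then g (a j) else 0))"
    by (intro sum.cong) auto
  then have "(\<Sum>j<M. if a j < t then g t - g (a j) else 0) / M = g t * (e t + t) - ?A"
    by (simp add: e_def sum_subtractf diff_divide_distrib flip: sum_distrib_left)
  \<comment> \<open>Summation by parts: the quadrature error is \<open>g t * e t\<close> minus the
    integral of \<open>g' * e\<close>.\<close>
  ultimately have V: "((\<lambda>r. g' r * e r) has_integral (g t * e t - (?A - integral {0..t} g))) {0..t}"
    by (simp add: algebra_simps)
  have "norm (g t * e t - (?A - integral {0..t} g)) \<le> (Lam * (2 * D1)) * measure lborel {0..t}"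
  proof (rule has_integral_bound_real[OF _ finite.emptyI V])
    have "Lam \<ge> 0" using Lam[of 0] by (auto intro: order_trans[OF abs_ge_zero])
    then show "0 \<le> Lam * (2 * D1)" using D1_nonneg by simp
    show "norm (g' r * e r) \<le> Lam * (2 * D1)" if "r \<in> {0..t} - {}" for r
      using that sub Lam[of r] e[of r] \<open>Lam \<ge> 0\<close> by (auto simp: abs_mult intro!: mult_mono)
  qed
  also have "\<dots> \<le> Lam * (2 * D1) * 1"
  proof -
    have "Lam \<ge> 0" using Lam[of 0] by (auto intro: order_trans[OF abs_ge_zero])
    then show ?thesis using t D1_nonneg by (intro mult_left_mono) auto
  qed
  finally have "\<bar>g t * e t - (?A - integral {0..t} g)\<bar> \<le> Lam * (2 * D1)" by simp
  moreover have "\<bar>g t * e t\<bar> \<le> 1 * (2 * D1)"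
    unfolding abs_mult using g[OF t] e[OF t] by (intro mult_mono) auto
  ultimately show ?thesis by (simp add: algebra_simps)
qed

text \<open>The sampler normalises by the accepted count \<open>n\<close> instead of
  \<open>M\<close>. As \<open>n' / n \<le> 1\<close>, this change costs a second
  \<open>E\<close>.\<close>

lemma ratio_diff_le:
  fixes n n' \<alpha> \<alpha>' M E :: real
  assumes "0 \<le> n'" "n' \<le> n" "n > 0" "\<alpha> > 0" "M > 0"
    and "\<bar>n' / M - \<alpha>'\<bar> \<le> E" "\<bar>n / M - \<alpha>\<bar> \<le> E"
  shows "\<bar>n' / n - \<alpha>' / \<alpha>\<bar> \<le> 2 * E / \<alpha>"
proof -
  have "n' / n - \<alpha>' / \<alpha> = ((n' / M - \<alpha>') - n' / n * (n / M - \<alpha>)) / \<alpha>"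
    using assms by (simp add: field_simps)
  also have "\<bar>\<dots>\<bar> = \<bar>(n' / M - \<alpha>') - n' / n * (n / M - \<alpha>)\<bar> / \<alpha>"
    using assms by simp
  also have "\<dots> \<le> (E + 1 * E) / \<alpha>"
  proof (rule divide_right_mono)
    have "\<bar>n' / n * (n / M - \<alpha>)\<bar> \<le> 1 * E"
      unfolding abs_mult using assms by (intro mult_mono) auto
    then show "\<bar>(n' / M - \<alpha>') - n' / n * (n / M - \<alpha>)\<bar> \<le> E + 1 * E"
      by (intro order_trans[OF abs_triangle_ineq4 add_mono] assms(6))
  qed (use assms in auto)
  finally show ?thesis by simp
qed

section \<open>The sampler, the normalising integral and the constants\<close>

lemma length_filter_upt: "length (filter P [0..<M]) = (\<Sum>j<M. if P j then 1 else 0)"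
  by (induction M) auto

lemma count_below_ar_sample:
  assumes L: "L > 0" and x: "\<And>j. j < M \<Longrightarrow> x j \<in> {0..<1} \<times> {0..<1}"
  shows "real (length (filter (\<lambda>y. y < t) (ar_sample \<psi> L M x))) = count_below (\<lambda>z. \<psi> z / L) M x t"
proof -
  have "length (filter (\<lambda>y. y < t) (ar_sample \<psi> L M x)) =
    length (filter (\<lambda>j. x j \<in> accept_region \<psi> L \<and> fst (x j) < t) [0..<M])"
    by (simp add: ar_sample_def filter_map o_def conj_commute)
  also have "real \<dots> = count_below (\<lambda>z. \<psi> z / L) M x t"
    unfolding length_filter_upt count_below_def of_nat_sum
  proof (intro sum.cong refl)
    fix j assume "j \<in> {..<M}"
    then have "x j \<in> {0..<1} \<times> {0..<1}" using x by simp
    then have "x j \<in> accept_region \<psi> L \<longleftrightarrow> snd (x j) \<le> \<psi> (fst (x j)) / L"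
      using L by (cases "x j") (auto simp: accept_region_def field_simps)
    then show "real (if x j \<in> accept_region \<psi> L \<and> fst (x j) < t then 1 else 0) =
      (if fst (x j) < t \<and> snd (x j) \<le> \<psi> (fst (x j)) / L then 1 else 0)"
      by auto
  qed
  finally show ?thesis .
qed

text \<open>A vanishing integral would force the continuous nonnegative \<open>\<psi>\<close> to be
  zero, and with it \<open>\<psi>''\<close> at every interior point.\<close>

lemma integral_pos_if_curved:
  fixes \<psi> \<psi>' \<psi>'' :: "real \<Rightarrow> real"
  assumes nonneg: "\<And>z. z \<in> {0..1} \<Longrightarrow> \<psi> z \<ge> 0"
    and d1: "\<And>z. z \<in> {0..1} \<Longrightarrow> (\<psi> has_real_derivative \<psi>' z) (at z within {0..1})"
    and d2: "\<And>z. z \<in> {0..1} \<Longrightarrow> (\<psi>' has_real_derivative \<psi>'' z) (at z within {0..1})"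
    and curv: "\<psi>'' (1/2) \<noteq> 0"
  shows "integral {0..1} \<psi> > 0"
proof -
  have c: "continuous_on {0..1} \<psi>"
    by (rule DERIV_continuous_on[OF d1])
  have zero_deriv: "f' z = 0"
    if "\<And>z. z \<in> {0..1} \<Longrightarrow> (f has_real_derivative f' z) (at z within {0..1})"
      "\<And>z. z \<in> {0<..<1} \<Longrightarrow> f z = 0" "z \<in> {0<..<1}" for f f' :: "real \<Rightarrow> real" and z
  proof -
    have "(f has_real_derivative f' z) (at z)"
      using that(1)[of z] that(3) by (simp add: at_within_Icc_at)
    then have "((\<lambda>_. 0) has_real_derivative f' z) (at z)"
      by (rule has_field_derivative_transform_within_open[of _ _ _ "{0<..<1}"]) (use that in auto)
    then show ?thesis using DERIV_unique DERIV_const by blast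
  qed
  have "integral {0..1} \<psi> \<noteq> 0"
  proof
    assume "integral {0..1} \<psi> = 0"
    then have "\<psi> z = 0" if "z \<in> {0..1}" for z
      using integral_eq_0_iff[OF c _ nonneg] that by auto
    then have "\<psi>' z = 0" if "z \<in> {0<..<1}" for z
      using zero_deriv[OF d1 _ that] by auto
    then have "\<psi>'' (1/2) = 0"
      using zero_deriv[OF d2, of "1/2"] by auto
    with curv show False by blast
  qed
  moreover have "integral {0..1} \<psi> \<ge> 0"
    using nonneg by (intro integral_nonneg integrable_continuous_real c) auto
  ultimately show ?thesis by linarith
qed

text \<open>The intermediate value theorem fixes the sign and compactness gives a positive minimum;
  these are the data for the second derivative test.\<close>

lemma nonvanishing_bounded_away:
  fixes f :: "real \<Rightarrow> real"
  assumes "continuous_on {0..1} f" "\<And>z. z \<in> {0..1} \<Longrightarrow> f z \<noteq> 0"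
  obtains s m where "\<bar>s\<bar> = 1" "m > 0" "\<And>z. z \<in> {0..1} \<Longrightarrow> s * f z \<ge> m"
proof -
  define s where "s = sgn (f 0)"
  have s: "\<bar>s\<bar> = 1" using assms(2)[of 0] by (simp add: s_def abs_sgn_eq)
  have c: "continuous_on {0..1} (\<lambda>z. s * f z)" by (intro continuous_intros assms)
  have pos: "s * f z > 0" if z: "z \<in> {0..1}" for z
  proof (rule ccontr)
    assume "\<not> s * f z > 0"
    moreover have "s * f 0 \<ge> 0" by (simp add: s_def sgn_real_def)
    ultimately obtain y where "0 \<le> y" "y \<le> z" "s * f y = 0"
      using IVT2'[of "\<lambda>z. s * f z" z 0 0] z continuous_on_subset[OF c, of "{0..z}"] by auto
    then show False using assms(2)[of y] z s by auto
  qed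
  obtain z0 where "z0 \<in> {0..1}" "\<And>z. z \<in> {0..1} \<Longrightarrow> s * f z0 \<le> s * f z"
    using continuous_attains_inf[OF _ _ c] by auto
  with that[OF s pos] show ?thesis by blast
qed

lemma discrepancy_below_graph:
  fixes g g' g'' :: "real \<Rightarrow> real"
  assumes range: "\<And>y. y \<in> {0..1} \<Longrightarrow> g y \<in> {0..1}"
    and d1: "\<And>z. z \<in> {0..1} \<Longrightarrow> (g has_real_derivative g' z) (at z within {0..1})"
    and d2: "\<And>z. z \<in> {0..1} \<Longrightarrow> (g' has_real_derivative g'' z) (at z within {0..1})"
    and cont: "continuous_on {0..1} g''"
    and curv: "\<And>z. z \<in> {0..1} \<Longrightarrow> g'' z \<noteq> 0"
  obtains c where "c \<ge> 0"
    "\<And>M x R t. M \<ge> 1 \<Longrightarrow> \<forall>j<M. x j \<in> {0..<1} \<times> {0..<1} \<Longrightarrow> R > 7 \<Longrightarrow> t \<in> {0..1} \<Longrightarrow>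
      \<bar>count_below g M x t / M - integral {0..t} g\<bar> \<le> c * Qcrit R M x"
proof -
  obtain s m where s: "\<bar>s\<bar> = 1" "m > 0" "\<And>z. z \<in> {0..1} \<Longrightarrow> s * g'' z \<ge> m"
    using nonvanishing_bounded_away[OF cont curv] by metis
  obtain Lam where Lam: "Lam \<ge> 1" "\<And>z. z \<in> {0..1} \<Longrightarrow> \<bar>g' z\<bar> \<le> Lam"
  proof -
    have "continuous_on {0..1} (\<lambda>z. \<bar>g' z\<bar>)"
      by (intro continuous_on_rabs DERIV_continuous_on[OF d2])
    then obtain z0 where z0: "\<forall>z\<in>{0..1}. \<bar>g' z\<bar> \<le> \<bar>g' z0\<bar>"
      using continuous_attains_sup[of "{0..1::real}" "\<lambda>z. \<bar>g' z\<bar>"] by auto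
    show ?thesis
      by (rule that[of "max 1 \<bar>g' z0\<bar>"]) (use z0 in \<open>auto simp: le_max_iff_disj\<close>)
  qed
  have lip: "\<bar>g y - g z\<bar> \<le> Lam * \<bar>y - z\<bar>" if "y \<in> {0..1}" "z \<in> {0..1}" for y z
    using field_differentiable_bound[of "{0..1}" g g' Lam] d1 Lam that by auto
  define C where "C = 4 + 10 / sqrt m * (2 * Lam) powr (3/2)"
  have C: "C \<ge> 0" using s(2) by (simp add: C_def)
  \<comment> \<open>The number 18 is 2 + 16 from \<open>saw_sum_bound\<close>, once both of its
    terms are bounded through \<open>Qcrit\<close>. Next, \<open>c2\<close> is the same expression
    for the flat curve, with slope bound 0 and the coefficient 4 of
    \<open>curve_integral_zero_bound\<close>.\<close>
  define c1 where "c1 = 2 * C + 2 * ((8 * Lam + 24) + 4 * 18)"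
  define c2 where "c2 = 2 * 4 + 2 * ((8 * 0 + 24) + 4 * 18 :: real)"
  define c where "c = c1 + c2 + (1 + Lam) * (2 * 18)"
  show ?thesis
  proof (rule that)
    show "c \<ge> 0" using C Lam(1) by (simp add: c_def c1_def c2_def)
    fix M :: nat and x :: "nat \<Rightarrow> real \<times> real" and R t :: real
    assume M: "M \<ge> 1" and "\<forall>j<M. x j \<in> {0..<1} \<times> {0..<1}" and R: "R > 7" and t: "t \<in> {0..1}"
    then have x: "\<And>j. j < M \<Longrightarrow> x j \<in> {0..<1} \<times> {0..<1}" by blast
    \<comment> \<open>Rounding up serves twice: \<open>K - 1 < R\<close> keeps the frequencies
      inside the criterion, and \<open>R \<le> K\<close> bounds the smoothing loss
      \<open>1 / K\<close> by \<open>1 / R\<close>. From \<open>R > 7\<close> follows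
      \<open>K \<ge> 8\<close>.\<close>
    define K where "K = nat \<lceil>R\<rceil>"
    have K: "K \<ge> 8" "real K \<ge> R" "real K - 1 < R"
      using R by (auto simp: K_def) linarith+
    have R0: "R > 0" using R by simp
    let ?Q = "Qcrit R M x"
    have Q: "1 / K \<le> ?Q"
    proof -
      have "1 / K \<le> 1 / R" using K R by (intro divide_left_mono) auto
      also have "\<dots> \<le> ?Q"
        unfolding Qcrit_freq_weight by (simp add: sum_nonneg freq_weight_nonneg)
      finally show ?thesis .
    qed
    have D1: "\<bar>(\<Sum>j<M. saw (fst (x j) - w)) / M\<bar> \<le> 18 * ?Q" for w
      using saw_sum_bound[OF K(1) M, of "\<lambda>j. fst (x j)" w] saw_exp_bound_le[OF R0 K(3), of M x] Q
      by simp
    have scale: "a / K \<le> a * ?Q" if "a \<ge> 0" for a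
      using mult_left_mono[OF Q that] by simp
    have B1: "\<bar>curve_avg g t M x w1 w2\<bar> \<le> c1 * ?Q" for w1 w2
    proof -
      have "\<bar>curve_avg g t M x w1 w2\<bar> \<le>
          2 * curve_exp_bound K g t M x + 2 * ((8 * Lam + 24) / K + 4 * (18 * ?Q))"
        using Lam(1) by (intro curve_avg_bound K M t lip D1) auto
      also have "\<dots> \<le> 2 * (C * ?Q) + 2 * ((8 * Lam + 24) * ?Q + 4 * (18 * ?Q))"
        using Lam(1) by (intro add_mono mult_left_mono scale curve_exp_bound_le R0 K C
            curve_integral_bound[OF d1 d2 cont Lam s(2,1,3) t, folded C_def]) auto
      finally show ?thesis by (simp add: c1_def algebra_simps)
    qed
    have B2: "\<bar>curve_avg (\<lambda>_. 0) t M x w1 w2\<bar> \<le> c2 * ?Q" for w1 w2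
    proof -
      have "\<bar>curve_avg (\<lambda>_. 0) t M x w1 w2\<bar> \<le>
          2 * curve_exp_bound K (\<lambda>_. 0) t M x + 2 * ((8 * 0 + 24) / K + 4 * (18 * ?Q))"
        by (intro curve_avg_bound K M t D1) auto
      also have "\<dots> \<le> 2 * (4 * ?Q) + 2 * ((8 * 0 + 24) * ?Q + 4 * (18 * ?Q))"
        by (intro add_mono mult_left_mono scale curve_exp_bound_le R0 K
            curve_integral_zero_bound[OF t]) auto
      finally show ?thesis by (simp add: c2_def algebra_simps)
    qed
    let ?A = "(\<Sum>j<M. if fst (x j) < t then g (fst (x j)) else 0) / M"
    have "\<bar>count_below g M x t / M - ?A\<bar> \<le> c1 * ?Q + c2 * ?Q"
      by (intro count_below_bound M x range B1 B2)
    moreover have "\<bar>?A - integral {0..t} g\<bar> \<le> (1 + Lam) * (2 * (18 * ?Q))"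
    proof (rule Koksma_C1[OF M t _ D1 d1 Lam(2)])
      show "fst (x j) \<in> {0..<1}" if "j < M" for j
        using x[OF that] by (auto simp: mem_Times_iff)
      show "\<bar>g z\<bar> \<le> 1" if "z \<in> {0..1}" for z
        using range[OF that] by auto
    qed
    ultimately show "\<bar>count_below g M x t / M - integral {0..t} g\<bar> \<le> c * ?Q"
      by (simp add: c_def algebra_simps)
  qed
qed

theorem theorem3:
  fixes \<psi> \<psi>' \<psi>'' :: "real \<Rightarrow> real" and L :: real
  assumes nonneg: "\<And>z. z \<in> {0..1} \<Longrightarrow> \<psi> z \<ge> 0"
    and d1: "\<And>z. z \<in> {0..1} \<Longrightarrow> (\<psi> has_real_derivative \<psi>' z) (at z within {0..1})"
    and d2: "\<And>z. z \<in> {0..1} \<Longrightarrow> (\<psi>' has_real_derivative \<psi>'' z) (at z within {0..1})"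
    and cont2: "continuous_on {0..1} \<psi>''"
    and curv: "\<And>z. z \<in> {0..1} \<Longrightarrow> \<psi>'' z \<noteq> 0"
    and bound: "\<And>z. z \<in> {0..1} \<Longrightarrow> \<psi> z \<le> L"
  shows "\<exists>c > 0. \<forall>M \<ge> 1. \<forall>x :: nat \<Rightarrow> real \<times> real. \<forall>R > 0.
           (\<forall>j < M. x j \<in> {0..<1} \<times> {0..<1}) \<longrightarrow>
           length (ar_sample \<psi> L M x) \<ge> 1 \<longrightarrow>
           star_disc_psi \<psi> (ar_sample \<psi> L M x) \<le> c * Qcrit R M x"
proof -
  have cont0: "continuous_on {0..1} \<psi>"
    by (rule DERIV_continuous_on[OF d1])
  have pos: "integral {0..1} \<psi> > 0"
    by (rule integral_pos_if_curved[OF nonneg d1 d2 curv]) auto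
  \<comment> \<open>\<open>L\<close> is given only as an upper bound; the positive integral makes it
    positive and so permits the division by \<open>L\<close>.\<close>
  have L: "L > 0"
  proof (rule ccontr)
    assume "\<not> L > 0"
    then have "\<psi> z = 0" if "z \<in> {0..1}" for z
      using nonneg[OF that] bound[OF that] by linarith
    then have "(\<psi> has_integral 0) {0..1}"
      by (rule has_integral_is_0)
    with pos show False by (simp add: integral_unique)
  qed
  define g where "g z = \<psi> z / L" for z
  have range: "g z \<in> {0..1}" if "z \<in> {0..1}" for z
    using nonneg[OF that] bound[OF that] L by (simp add: g_def)
  obtain c0 where c0: "c0 \<ge> 0"
    "\<And>M x R t. M \<ge> 1 \<Longrightarrow> \<forall>j<M. x j \<in> {0..<1} \<times> {0..<1} \<Longrightarrow> R > 7 \<Longrightarrow> t \<in> {0..1} \<Longrightarrow>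
      \<bar>count_below g M x t / M - integral {0..t} g\<bar> \<le> c0 * Qcrit R M x"
  proof (rule discrepancy_below_graph[of g "\<lambda>z. \<psi>' z / L" "\<lambda>z. \<psi>'' z / L"])
    show "g y \<in> {0..1}" if "y \<in> {0..1}" for y by (rule range[OF that])
    show "(g has_real_derivative \<psi>' z / L) (at z within {0..1})" if "z \<in> {0..1}" for z
      unfolding g_def using d1[OF that] by (rule DERIV_cdivide)
    show "((\<lambda>z. \<psi>' z / L) has_real_derivative \<psi>'' z / L) (at z within {0..1})" if "z \<in> {0..1}" for z
      using d2[OF that] by (rule DERIV_cdivide)
    show "continuous_on {0..1} (\<lambda>z. \<psi>'' z / L)"
      using L by (intro continuous_intros cont2) auto
    show "\<psi>'' z / L \<noteq> 0" if "z \<in> {0..1}" for z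
      using curv[OF that] L by simp
  qed (rule that)
  define \<alpha> where "\<alpha> = integral {0..1} g"
  have int_g: "integral {0..t} g = integral {0..t} \<psi> / L" for t
    by (simp add: g_def[abs_def])
  have \<alpha>: "\<alpha> > 0" using pos L by (simp add: \<alpha>_def int_g)
  \<comment> \<open>The summand 7 covers \<open>R \<le> 7\<close>, where the criterion is at least
    1/7 and the discrepancy at most 1; the other one comes from \<open>ratio_diff_le\<close> for
    \<open>R > 7\<close>.\<close>
  define c where "c = 7 + 2 * c0 / \<alpha>"
  have "star_disc_psi \<psi> (ar_sample \<psi> L M x) \<le> c * Qcrit R M x"
    if M: "M \<ge> 1" and R: "R > 0" and x: "\<forall>j < M. x j \<in> {0..<1} \<times> {0..<1}"
      and len: "length (ar_sample \<psi> L M x) \<ge> 1" for M x R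
    unfolding star_disc_psi_def
  proof (rule cSUP_least)
    fix t :: real assume t: "t \<in> {0..1}"
    let ?p = "ar_sample \<psi> L M x" and ?Q = "Qcrit R M x"
    have Q: "?Q \<ge> 1 / R"
      unfolding Qcrit_freq_weight by (simp add: sum_nonneg freq_weight_nonneg)
    then have Q0: "?Q \<ge> 0" using R by (meson divide_nonneg_pos order_trans zero_le_one)
    have nt: "real (length (filter (\<lambda>y. y < t) ?p)) = count_below g M x t"
      using count_below_ar_sample[OF L, of M x t \<psi>] x by (simp add: g_def[abs_def])
    have n: "real (length ?p) = count_below g M x 1"
    proof -
      \<comment> \<open>First coordinates lie strictly below 1, so the strict cut at
        \<open>t = 1\<close> counts every accepted point.\<close>
      have "filter (\<lambda>y. y < 1) ?p = ?p"
        using x by (intro filter_True) (auto simp: ar_sample_def mem_Times_iff)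
      then show ?thesis
        using count_below_ar_sample[OF L, of M x 1 \<psi>] x by (simp add: g_def[abs_def])
    qed
    have ratio: "integral {0..t} \<psi> / integral {0..1} \<psi> = integral {0..t} g / \<alpha>"
      using L by (simp add: \<alpha>_def int_g)
    have nt_le: "count_below g M x t \<le> count_below g M x 1" "count_below g M x t \<ge> 0" "count_below g M x 1 > 0"
      using len unfolding nt [symmetric] n [symmetric] by auto
    have "\<bar>count_below g M x t / count_below g M x 1 - integral {0..t} g / \<alpha>\<bar> \<le> c * ?Q"
    proof (cases "R > 7")
      case True
      have "\<bar>count_below g M x t / count_below g M x 1 - integral {0..t} g / \<alpha>\<bar> \<le> 2 * (c0 * ?Q) / \<alpha>"
        unfolding \<alpha>_def using c0(2)[OF M x True] t nt_le \<alpha> M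
        by (intro ratio_diff_le[where M = M]) (auto simp: \<alpha>_def)
      also have "\<dots> \<le> c * ?Q" using Q0 by (simp add: c_def algebra_simps)
      finally show ?thesis .
    next
      case False
      have sub: "{0..t} \<subseteq> {0..1}" using t by auto
      have gi: "g integrable_on S" if "S = {0..u}" "u \<le> 1" for S u
        unfolding that(1) g_def using that(2) L
        by (intro integrable_continuous_real continuous_intros continuous_on_subset[OF cont0]) auto
      have "integral {0..t} g \<ge> 0" using range sub t
        by (intro integral_nonneg gi[of _ t]) (auto)
      moreover have "integral {0..t} g \<le> \<alpha>"
        unfolding \<alpha>_def using range t by (intro integral_subset_le sub gi) auto
      ultimately have "integral {0..t} g / \<alpha> \<ge> 0" "integral {0..t} g / \<alpha> \<le> 1"
        using \<alpha> by simp_all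
      moreover have "count_below g M x t / count_below g M x 1 \<ge> 0" "count_below g M x t / count_below g M x 1 \<le> 1"
        using nt_le by simp_all
      ultimately have "\<bar>count_below g M x t / count_below g M x 1 - integral {0..t} g / \<alpha>\<bar> \<le> 1"
        by linarith
      also have "1 \<le> 7 * ?Q"
      proof -
        have "1 / 7 \<le> 1 / R" using False R by (intro divide_left_mono) auto
        then show ?thesis using Q by linarith
      qed
      also have "7 * ?Q \<le> c * ?Q"
        using c0(1) \<alpha> Q0 by (intro mult_right_mono) (auto simp: c_def)
      finally show ?thesis .
    qed
    then show "\<bar>real (length (filter (\<lambda>y. y < t) ?p)) / real (length ?p)
      - integral {0..t} \<psi> / integral {0..1} \<psi>\<bar> \<le> c * ?Q"
      unfolding nt n ratio .
  qed auto
  moreover have "c > 0" using c0(1) \<alpha> by (simp add: c_def add_pos_nonneg)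
  ultimately show ?thesis by blast
qed

end
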